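(* Let $(X_k)_{k\in\mathbb Z}$ be a stationary, $\alpha$-mixing, complex valued process with $E(|X_k|^2)<\infty$. Let $I=[0,2\pi)\setminus 2\pi\mathbb Q$, and for $\beta\in I$ let $Y_n^{(\beta)}=(S_n^{(\beta)},e^{in\beta})$, $n\ge 1$, be the random walk in $G=\mathbb C\rtimes S^1$ with $$S_n^{(\beta)}=e^{i(n-1)\beta}\sum_{k=0}^{n-1}X_k\,e^{-i\beta k}.$$ Then there is a set of full Lebesgue measure in $I$ such that for every $\beta$ in this set the random walk $(Y_n^{(\beta)})_{n\ge 1}$ is recurrent. Furthermore, if in addition $\sum_{k=0}^\infty |E(X_k\cdot\overline{X_0})|<\infty$, then $(Y_n^{(\beta)})_{n\ge1}$ is recurrent for every $\beta\in I$.
   Context: $\alpha$-mixing: for $n\in\mathbb Z$ let $\mathfrak P_n$ be the sigma algebra generated by $\{X_k\}_{k\le n}$ and $\mathfrak F_n$ the sigma algebra generated by $\{X_k\}_{k>n}$. The process $(X_k)_{k\in\mathbb Z}$ is $\alpha$-mixing if $\alpha(n)=\sup_{A\in\mathfrak P_0,\,B\in\mathfrak F_n}|P(A\cap B)-P(A)P(B)|\to 0$ as $n\to\infty$. Group: $G=\mathbb C\rtimes S^1=\{(z,e^{i\gamma}):z\in\mathbb C,\gamma\in[0,2\pi)\}$ carries the product topology and the group operation $(z_2,e^{i\gamma_2})\cdot(z_1,e^{i\gamma_1})=(z_2+e^{i\gamma_2}z_1,e^{i(\gamma_2+\gamma_1)})$, with identity $1_G=(0,1)$. With $Z_k=(X_k,e^{i\beta})$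 one has $Y_n^{(\beta)}=Z_{n-1}\cdots Z_1\cdot Z_0$; equivalently $S_0^{(\beta)}=0$ and $S_n^{(\beta)}=e^{i\beta}S_{n-1}^{(\beta)}+X_{n-1}$. Recurrence: a stationary $G$-valued process $(Z_k)_{k\in\mathbb Z}$ is realized as $Z_k=f\circ T^k$, where $T$ is an invertible probability-preserving transformation of a standard probability space $(X,\mathfrak B,\mu)$ (for instance the shift on the canonical path space) and $f:X\to G$ is Borel. Define $\mathbf f(n,x)=f(T^{n-1}x)\cdots f(Tx)f(x)$ for $n\ge1$, $\mathbf f(0,x)=1_G$, $\mathbf f(n,x)=\mathbf f(-n,T^nx)^{-1}$ for $n<0$. The random walk $Z_{n-1}\cdots Z_0=\mathbf f(n,\cdot)$ is recurrent if for every measurable $B$ with $\mu(B)>0$ and every open neighbourhood $U$ of $1_G$ there is an integer $n\ne0$ with $\mu(B\cap T^{-n}B\cap\{x:\mathbf f(n,x)\in U\})>0$. *)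

theory Defs
  imports "HOL-Probability.Probability" "HOL-Algebra.Group"
begin

section \<open>Stationary and strongly mixing processes\<close>

definition process_law :: "'a measure \<Rightarrow> 's measure \<Rightarrow> (int \<Rightarrow> 'a \<Rightarrow> 's) \<Rightarrow> (int \<Rightarrow> 's) measure" where
  "process_law M S X = distr M (Pi\<^sub>M UNIV (\<lambda>_. S)) (\<lambda>\<omega> k. X k \<omega>)"

definition stationary_process :: "'a measure \<Rightarrow> 's measure \<Rightarrow> (int \<Rightarrow> 'a \<Rightarrow> 's) \<Rightarrow> bool" where
  "stationary_process M S X \<longleftrightarrow>
     (\<forall>k. X k \<in> measurable M S) \<and>
     (\<forall>h. process_law M S (\<lambda>k. X (k + h)) = process_law M S X)"

definition generated_events ::
  "'a measure \<Rightarrow> (int \<Rightarrow> 'a \<Rightarrow> complex) \<Rightarrow> int set \<Rightarrow> 'a set set" where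
  "generated_events M X K =
     sigma_sets (space M) {X k -` C \<inter> space M | k C. k \<in> K \<and> C \<in> sets borel}"

definition alpha_coeff :: "'a measure \<Rightarrow> (int \<Rightarrow> 'a \<Rightarrow> complex) \<Rightarrow> int \<Rightarrow> real" where
  "alpha_coeff M X n =
     (SUP (A, B) \<in> generated_events M X {..0} \<times> generated_events M X {n<..}.
        \<bar>measure M (A \<inter> B) - measure M A * measure M B\<bar>)"

definition alpha_mixing :: "'a measure \<Rightarrow> (int \<Rightarrow> 'a \<Rightarrow> complex) \<Rightarrow> bool" where
  "alpha_mixing M X \<longleftrightarrow> (\<lambda>n::nat. alpha_coeff M X (int n)) \<longlonglongrightarrow> 0"


section \<open>The group of orientation preserving motions of the plane\<close>

text \<open>
  The topology of the group is the subspace topology of its carrier in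
  \<^typ>\<open>complex \<times> complex\<close>; the second component is a point of the unit circle.
\<close>

definition motion_group :: "(complex \<times> complex) monoid" where
  "motion_group =
     \<lparr>carrier = UNIV \<times> sphere 0 1,
      mult = (\<lambda>(z2, u2) (z1, u1). (z2 + u2 * z1, u2 * u1)),
      one = (0, 1)\<rparr>"

definition motion_borel :: "(complex \<times> complex) measure" where
  "motion_borel = restrict_space borel (carrier motion_group)"

primrec left_product :: "(nat \<Rightarrow> complex \<times> complex) \<Rightarrow> nat \<Rightarrow> complex \<times> complex" where
  "left_product g 0 = \<one>\<^bsub>motion_group\<^esub>"
| "left_product g (Suc n) = g n \<otimes>\<^bsub>motion_group\<^esub> left_product g n"


section \<open>Cocycles over automorphisms of standard probability spaces\<close>

definition standard_prob_space :: "'b measure \<Rightarrow> bool" where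
  "standard_prob_space N \<longleftrightarrow>
     prob_space N \<and>
     (\<exists>\<T>. completely_metrizable_space \<T> \<and> second_countable \<T> \<and>
          topspace \<T> = space N \<and> sets N = sigma_sets (space N) {U. openin \<T> U})"

definition pp_automorphism :: "'b measure \<Rightarrow> ('b \<Rightarrow> 'b) \<Rightarrow> bool" where
  "pp_automorphism N T \<longleftrightarrow>
     bij_betw T (space N) (space N) \<and>
     T \<in> measurable N N \<and> the_inv_into (space N) T \<in> measurable N N \<and>
     distr N N T = N"

definition int_iterate :: "'b measure \<Rightarrow> ('b \<Rightarrow> 'b) \<Rightarrow> int \<Rightarrow> 'b \<Rightarrow> 'b" where
  "int_iterate N T n =
     (if 0 \<le> n then T ^^ nat n else the_inv_into (space N) T ^^ nat (- n))"

definition cocycle ::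
  "'b measure \<Rightarrow> ('b \<Rightarrow> 'b) \<Rightarrow> ('b \<Rightarrow> complex \<times> complex) \<Rightarrow> int \<Rightarrow> 'b \<Rightarrow> complex \<times> complex" where
  "cocycle N T f n x =
     (if 0 \<le> n then left_product (\<lambda>k. f ((T ^^ k) x)) (nat n)
      else m_inv motion_group
             (left_product (\<lambda>k. f ((T ^^ k) (int_iterate N T n x))) (nat (- n))))"

definition recurrent_cocycle ::
  "'b measure \<Rightarrow> ('b \<Rightarrow> 'b) \<Rightarrow> ('b \<Rightarrow> complex \<times> complex) \<Rightarrow> bool" where
  "recurrent_cocycle N T f \<longleftrightarrow>
     (\<forall>B \<in> sets N. \<forall>U. measure N B > 0 \<longrightarrow>
        openin (top_of_set (carrier motion_group)) U \<longrightarrow> \<one>\<^bsub>motion_group\<^esub> \<in> U \<longrightarrow>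
        (\<exists>n. n \<noteq> 0 \<and>
           measure N (B \<inter> (int_iterate N T n -` B \<inter> space N)
                        \<inter> {x \<in> space N. cocycle N T f n x \<in> U}) > 0))"


section \<open>Recurrence of random walks\<close>

definition realization ::
  "'a measure \<Rightarrow> (int \<Rightarrow> 'a \<Rightarrow> complex \<times> complex)
     \<Rightarrow> 'b measure \<Rightarrow> ('b \<Rightarrow> 'b) \<Rightarrow> ('b \<Rightarrow> complex \<times> complex) \<Rightarrow> bool" where
  "realization M Z N T f \<longleftrightarrow>
     standard_prob_space N \<and> pp_automorphism N T \<and> f \<in> measurable N motion_borel \<and>
     process_law N motion_borel (\<lambda>k x. f (int_iterate N T k x)) = process_law M motion_borel Z"

text \<open>
  Recurrence of a walk \<open>Y\<^sub>n = Z\<^sub>n\<^sub>-\<^sub>1 \<cdots> Z\<^sub>0\<close>, \<open>n \<ge> 1\<close>, with stationary increments is required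
  in every realization of \<open>Z\<close> on a space of points of type \<^typ>\<open>'b\<close>. The values \<open>Y\<^sub>n\<close>
  determine \<open>Z\<^sub>k\<close> for \<open>k \<ge> 0\<close>, hence by stationarity the law of \<open>Z\<close>, so that the choice of
  \<open>Z\<close> is immaterial. For \<open>'b = int \<Rightarrow> complex \<times> complex\<close> there is a realization,
  see \<open>canonical_realization\<close> below.
\<close>

definition recurrent_walk ::
  "'b itself \<Rightarrow> 'a measure \<Rightarrow> (nat \<Rightarrow> 'a \<Rightarrow> complex \<times> complex) \<Rightarrow> bool" where
  "recurrent_walk _ M Y \<longleftrightarrow>
     (\<exists>Z. stationary_process M motion_borel Z \<and>
          (\<forall>n\<ge>1. \<forall>\<omega>\<in>space M. Y n \<omega> = left_product (\<lambda>k. Z (int k) \<omega>) n) \<and>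
          (\<forall>(N :: 'b measure) T f. realization M Z N T f \<longrightarrow> recurrent_cocycle N T f))"

definition rotated_sum :: "real \<Rightarrow> (int \<Rightarrow> 'a \<Rightarrow> complex) \<Rightarrow> nat \<Rightarrow> 'a \<Rightarrow> complex" where
  "rotated_sum \<beta> X n \<omega> =
     cis ((real n - 1) * \<beta>) * (\<Sum>k<n. X (int k) \<omega> * cis (- \<beta> * real k))"

definition motion_walk ::
  "real \<Rightarrow> (int \<Rightarrow> 'a \<Rightarrow> complex) \<Rightarrow> nat \<Rightarrow> 'a \<Rightarrow> complex \<times> complex" where
  "motion_walk \<beta> X n \<omega> = (rotated_sum \<beta> X n \<omega>, cis (real n * \<beta>))"

definition irrational_angles :: "real set" where
  "irrational_angles = {0..<2 * pi} - (\<lambda>q. 2 * pi * q) ` \<rat>"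


section \<open>Consistency of the definitions\<close>

lemma group_motion_group: "group motion_group"
proof (rule groupI)
  fix x assume "x \<in> carrier motion_group"
  then obtain z u where x: "x = (z, u)" and u: "cmod u = 1"
    by (auto simp: motion_group_def)
  have "u \<noteq> 0" using u by auto
  then show "\<exists>y\<in>carrier motion_group. y \<otimes>\<^bsub>motion_group\<^esub> x = \<one>\<^bsub>motion_group\<^esub>"
    by (intro bexI[of _ "(- inverse u * z, inverse u)"])
       (auto simp: motion_group_def x u norm_inverse)
qed (auto simp: motion_group_def norm_mult algebra_simps)

lemma motion_walk_eq_left_product:
  "motion_walk \<beta> X n \<omega> = left_product (\<lambda>k. (X (int k) \<omega>, cis \<beta>)) n"
proof (induction n)
  case 0
  then show ?case by (simp add: motion_walk_def rotated_sum_def motion_group_def)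
next
  case (Suc n)
  have 1: "cis (real n * \<beta>) * s = cis \<beta> * (cis ((real n - 1) * \<beta>) * s)" for s
    by (simp add: cis_mult algebra_simps flip: mult.assoc)
  have 2: "cis (real n * \<beta>) * (x * cis (- \<beta> * real n)) = x" for x
  proof -
    have "cis (real n * \<beta>) * cis (- \<beta> * real n) = 1"
      by (simp add: cis_mult algebra_simps)
    then show ?thesis by (metis mult.left_commute mult.right_neutral)
  qed
  have "rotated_sum \<beta> X (Suc n) \<omega>
      = cis (real n * \<beta>) * (\<Sum>k<n. X (int k) \<omega> * cis (- \<beta> * real k))
        + cis (real n * \<beta>) * (X (int n) \<omega> * cis (- \<beta> * real n))"
    by (simp add: rotated_sum_def distrib_left)
  also have "\<dots> = X (int n) \<omega> + cis \<beta> * rotated_sum \<beta> X n \<omega>"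
    unfolding 2 unfolding 1 rotated_sum_def by (rule add.commute)
  finally show ?case
    by (simp add: Suc[symmetric] motion_walk_def motion_group_def cis_mult algebra_simps)
qed

lemma space_motion_borel: "space motion_borel = carrier motion_group"
  by (simp add: motion_borel_def space_restrict_space)

lemma space_paths:
  "space (Pi\<^sub>M (UNIV :: int set) (\<lambda>_. motion_borel)) = {w. \<forall>k. w k \<in> carrier motion_group}"
  by (auto simp: space_PiM space_motion_borel PiE_def)

lemma closed_paths: "closed {w :: int \<Rightarrow> complex \<times> complex. \<forall>k. w k \<in> carrier motion_group}"
proof -
  have eq: "{w :: int \<Rightarrow> complex \<times> complex. \<forall>k. w k \<in> carrier motion_group}
      = (\<Inter>k. (\<lambda>w. w k) -` carrier motion_group)" by auto
  have "closed (carrier motion_group)"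
    by (simp add: motion_group_def closed_Times)
  then show ?thesis unfolding eq
    by (intro closed_INT ballI closed_vimage continuous_on_product_coordinates) auto
qed

lemma sets_paths:
  "sets (Pi\<^sub>M (UNIV :: int set) (\<lambda>_. motion_borel))
     = sets (restrict_space borel {w. \<forall>k. w k \<in> carrier motion_group})"
  (is "sets ?P = sets ?R")
proof
  have "(\<lambda>w. w) \<in> measurable ?P (Pi\<^sub>M UNIV (\<lambda>_. borel))"
  proof (rule measurable_PiM_single')
    fix k :: int
    have "(\<lambda>w. w k) \<in> measurable ?P motion_borel"
      by (intro measurable_component_singleton) simp
    then show "(\<lambda>w. w k) \<in> borel_measurable ?P"
      unfolding motion_borel_def by (simp add: measurable_restrict_space2_iff)
  qed auto
  then have "(\<lambda>w. w) \<in> measurable ?P borel"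
    by (subst (asm) measurable_cong_sets[OF refl sets_PiM_equal_borel])
  then have "(\<lambda>w. w) \<in> measurable ?P ?R"
    by (intro measurable_restrict_space2) (auto simp: space_paths)
  then show "sets ?R \<subseteq> sets ?P"
  proof (intro subsetI)
    fix A assume "(\<lambda>w. w) \<in> measurable ?P ?R" "A \<in> sets ?R"
    then have "(\<lambda>w. w) -` A \<inter> space ?P \<in> sets ?P" by (rule measurable_sets)
    moreover have "A \<subseteq> space ?P"
      using sets.sets_into_space[OF \<open>A \<in> sets ?R\<close>] by (simp add: space_paths space_restrict_space)
    ultimately show "A \<in> sets ?P" by (simp add: Int_absorb2)
  qed
next
  have "(\<lambda>w. w) \<in> measurable ?R ?P"
  proof (rule measurable_PiM_single')
    fix k :: int
    have "(\<lambda>w :: int \<Rightarrow> complex \<times> complex. w k) \<in> borel_measurable borel"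
      by (intro borel_measurable_continuous_onI continuous_on_product_coordinates)
    then show "(\<lambda>w. w k) \<in> measurable ?R motion_borel"
      unfolding motion_borel_def
      by (intro measurable_restrict_space2 measurable_restrict_space1)
         (auto simp: space_restrict_space)
  qed (auto simp: space_motion_borel space_restrict_space)
  then show "sets ?P \<subseteq> sets ?R"
  proof (intro subsetI)
    fix A assume "(\<lambda>w. w) \<in> measurable ?R ?P" "A \<in> sets ?P"
    then have "(\<lambda>w. w) -` A \<inter> space ?R \<in> sets ?R" by (rule measurable_sets)
    moreover have "A \<subseteq> space ?R"
      using sets.sets_into_space[OF \<open>A \<in> sets ?P\<close>] by (simp add: space_paths space_restrict_space)
    ultimately show "A \<in> sets ?R" by (simp add: Int_absorb2)
  qed
qed

lemma canonical_realization:
  assumes "prob_space M" and stat: "stationary_process M motion_borel Z"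
  shows "realization M Z (process_law M motion_borel Z) (\<lambda>w k. w (k + 1)) (\<lambda>w. w 0)"
proof -
  define P where "P = Pi\<^sub>M (UNIV :: int set) (\<lambda>_. motion_borel)"
  define N where "N = process_law M motion_borel Z"
  define T :: "(int \<Rightarrow> complex \<times> complex) \<Rightarrow> int \<Rightarrow> complex \<times> complex"
    where "T = (\<lambda>w k. w (k + 1))"
  define S :: "(int \<Rightarrow> complex \<times> complex) set"
    where "S = {w. \<forall>k. w k \<in> carrier motion_group}"
  interpret prob_space M by fact
  have Zm: "(\<lambda>\<omega> k. Z (k + h) \<omega>) \<in> measurable M P" for h
    using stat unfolding P_def stationary_process_def
    by (intro measurable_PiM_single') (auto intro: measurable_space)
  have law: "distr M P (\<lambda>\<omega> k. Z (k + h) \<omega>) = N" for h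
    using stat by (simp add: stationary_process_def process_law_def N_def P_def)
  have N: "N = distr M P (\<lambda>\<omega> k. Z k \<omega>)" by (simp add: N_def P_def process_law_def)
  have sN: "sets N = sets P" and spN: "space N = S"
    by (simp_all add: N P_def space_paths S_def)
  have shift: "(\<lambda>w k. w (k + h)) \<in> measurable P P" for h :: int
    unfolding P_def by (intro measurable_PiM_single') (auto simp: space_PiM)
  have inv: "the_inv_into S T w = (\<lambda>k. w (k - 1))" if "w \<in> S" for w
  proof (rule the_inv_into_f_eq)
    show "inj_on T S"
      by (rule inj_on_inverseI[where g = "\<lambda>w k. w (k - 1)"]) (simp add: T_def)
  qed (use that in \<open>auto simp: T_def S_def\<close>)
  have "prob_space N"
    using Zm[of 0] by (simp add: N prob_space_distr)
  moreover have "\<exists>\<T>. completely_metrizable_space \<T> \<and> second_countable \<T> \<and>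
      topspace \<T> = space N \<and> sets N = sigma_sets (space N) {U. openin \<T> U}"
  proof (intro exI conjI)
    show "completely_metrizable_space (top_of_set S)"
      using closed_paths completely_metrizable_space_closedin
        completely_metrizable_space_euclidean
      by (metis S_def closed_closedin)
    show "second_countable (top_of_set S)"
    proof (rule second_countable_subtopology)
      obtain \<B> :: "(int \<Rightarrow> complex \<times> complex) set set"
        where "countable \<B>" "topological_basis \<B>" using ex_countable_basis by blast
      then show "second_countable (euclidean :: (int \<Rightarrow> complex \<times> complex) topology)"
        unfolding second_countable_def
        by (metis open_openin topological_basis_def topological_basisE topological_basis_open)
    qed
    show "topspace (top_of_set S) = space N" by (simp add: spN)
    have "sets N = sets (restrict_space borel S)"
      by (simp add: sN P_def S_def sets_paths)
    also have "\<dots> = (\<inter>) S ` sigma_sets UNIV {U. open U}"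
      by (simp add: sets_restrict_space borel_def)
    also have "\<dots> = sigma_sets S ((\<inter>) S ` {U. open U})"
    proof (rule sigma_sets_Int)
      have "S \<in> sets borel" using closed_paths by (simp add: S_def)
      then show "S \<in> sigma_sets UNIV {U. open U}" by (simp add: borel_def)
    qed simp
    also have "(\<inter>) S ` {U. open U} = {U. openin (top_of_set S) U}"
      by (auto simp: openin_open)
    finally show "sets N = sigma_sets (space N) {U. openin (top_of_set S) U}"
      by (simp add: spN)
  qed
  ultimately have "standard_prob_space N"
    by (simp add: standard_prob_space_def)
  moreover have "pp_automorphism N T"
    unfolding pp_automorphism_def
  proof (intro conjI)
    show "bij_betw T (space N) (space N)"
      unfolding spN
      by (rule bij_betw_byWitness[where f' = "\<lambda>w k. w (k - 1)"]) (auto simp: T_def S_def)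
    show T: "T \<in> measurable N N"
      using shift[of 1] by (simp add: T_def measurable_cong_sets[OF sN sN])
    have "(\<lambda>w k. w (k - 1)) \<in> measurable N N"
      using shift[of "-1"] by (simp add: measurable_cong_sets[OF sN sN])
    then show "the_inv_into (space N) T \<in> measurable N N"
      by (rule measurable_cong[THEN iffD1, rotated]) (simp add: spN inv)
    have "distr N N T = distr N P T" by (rule distr_cong) (simp_all add: sN)
    also have "\<dots> = distr M P (T \<circ> (\<lambda>\<omega> k. Z k \<omega>))"
      unfolding N using shift[of 1] Zm[of 0] by (subst distr_distr) (simp_all add: T_def)
    also have "\<dots> = N" using law[of 1] by (simp add: T_def comp_def)
    finally show "distr N N T = N" .
  qed
  moreover have f: "(\<lambda>w. w 0) \<in> measurable N motion_borel"
    by (simp add: measurable_cong_sets[OF sN refl] P_def)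
  moreover have "process_law N motion_borel (\<lambda>k w. int_iterate N T k w 0) = N"
  proof -
    have pos: "(T ^^ n) w = (\<lambda>k. w (k + int n))" for n w
      by (induction n) (auto simp: T_def algebra_simps)
    have neg: "(the_inv_into S T ^^ n) w = (\<lambda>k. w (k - int n))" if "w \<in> S" for n w
    proof (induction n)
      case (Suc n)
      have "(\<lambda>k. w (k - int n)) \<in> S" using that by (simp add: S_def)
      then show ?case by (simp add: Suc inv algebra_simps)
    qed simp
    have "int_iterate N T k w 0 = w k" if "w \<in> space N" for k w
      using that by (simp add: int_iterate_def spN pos neg)
    then have "process_law N motion_borel (\<lambda>k w. int_iterate N T k w 0) = distr N P (\<lambda>w. w)"
      unfolding process_law_def P_def by (intro distr_cong) auto
    also have "\<dots> = N" by (rule distr_id2) (simp add: sN)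
    finally show ?thesis .
  qed
  ultimately show ?thesis
    by (simp add: realization_def N_def T_def)
qed

end

theory Submission
  imports Defs
begin

text \<open>
  Write \<open>W n = (\<Sum>k<n. cis (- k \<beta>) X k)\<close>, so that \<open>\<bar>W n\<bar> = \<bar>S n\<bar>\<close>. If the walk misses a
  neighbourhood of the identity on returns to a set \<open>B\<close>, then the times of visit to \<open>B\<close> with
  \<open>\<bar>W n\<bar> \<le> R\<close> occupy different cells of a grid, so there are at most of the order \<open>R\<^sup>2\<close>
  of them.

  Conversely, let \<open>E \<bar>W n\<bar> \<le> C sqrt n\<close>. Two blocks of length about \<open>n\<close>, separated by a bounded gap
  which makes them nearly independent and the second one rotated by almost \<open>\<pi>\<close>, are nearly
  equidistributed; by the pigeonhole principle they nearly cancel, up to \<open>R \<le> sqrt n\<close>, with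
  probability at least of the order \<open>R\<^sup>2 / n\<close>. Summing over \<open>n\<close> and over \<open>J\<close> dyadic radii
  \<open>R\<close> for each \<open>n\<close> contradicts the packing bound for large \<open>J\<close>, provided that the good \<open>n\<close>
  have positive upper logarithmic density.

  With summable covariances every \<open>n\<close> is good. In general \<open>E \<bar>W n\<bar>\<^sup>2 / n\<close> has a mean over
  \<open>\<beta>\<close> that is independent of \<open>n\<close>, and Fatou's lemma applied to its logarithmic means gives
  the density for almost every \<open>\<beta>\<close>.
\<close>

section \<open>Irrational rotations and measure preserving systems\<close>

text \<open>Mixing comes without a rate, so no limit theorem describes the law of
  \<open>W n\<close>; only the size of its first moment is known at the good times. Two independent
  copies of any law of that size are often close to each other, but here their sum has to be small.
  This is why the second block must be turned by about \<pi>, and why the waiting time for such a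
  rotation has to be bounded. The circle component is compact: it costs a constant factor in the
  packing bound and does not enter the lower bound, which concerns norms only. Return probabilities
  of order \<open>R\<^sup>2 / n\<close> against at most order \<open>R\<^sup>2\<close> visits are
  both of logarithmic size when summed, so a single radius per time gives no contradiction. Hence
  the many radii, and the weights \<open>1 / n\<close> in the density. The set \<open>B\<close>
  belongs to the sigma algebra of the realization, which may be larger than the one generated by the
  process, while mixing speaks about process events only. Mixing against \<open>B\<close> is
  therefore derived separately, at the price of \<open>q\<close> final steps that the return event
  must leave free.\<close>

lemma norm_cis_minus_one_le: "cmod (cis x - 1) \<le> \<bar>x\<bar>"
proof -
  have "(cmod (cis x - 1))\<^sup>2 = (cos x - 1)\<^sup>2 + (sin x)\<^sup>2"
    by (simp add: cmod_power2)
  also have "\<dots> = 2 - 2 * cos x"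
    using sin_cos_squared_add[of x] by (simp add: power2_eq_square algebra_simps)
  also have "\<dots> = (2 * sin (x / 2))\<^sup>2"
    using cos_double_sin[of "x / 2"] by (simp add: power2_eq_square)
  also have "\<dots> \<le> \<bar>x\<bar>\<^sup>2"
    unfolding power2_abs
    using abs_sin_x_le_abs_x[of "x / 2"] by (intro abs_le_square_iff[THEN iffD1]) simp
  finally show ?thesis by (rule power2_le_imp_le) simp
qed

lemma irrational_angle_quotient:
  assumes "\<beta> \<in> irrational_angles"
  shows "\<beta> / (2 * pi) \<notin> \<rat>"
proof
  assume "\<beta> / (2 * pi) \<in> \<rat>"
  moreover have "\<beta> = 2 * pi * (\<beta> / (2 * pi))" by simp
  ultimately show False using assms unfolding irrational_angles_def by blast
qed

lemma irrational_rotation_dense: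
  assumes "\<beta> \<in> irrational_angles" "0 < \<epsilon>" "cmod u = 1"
  shows "\<exists>r::nat. dist (cis (real r * \<beta>)) u < \<epsilon>"
proof -
  have u: "u = cis (Arg u)"
    using assms(3) cis_Arg[of u] by (cases "u = 0") (auto simp: sgn_eq)
  obtain h k :: int where k: "0 < k" and
    close: "\<bar>of_int k * (\<beta> / (2 * pi)) - of_int h - Arg u / (2 * pi)\<bar> < \<epsilon> / (2 * pi)"
    using sequence_of_fractional_parts_is_dense[OF irrational_angle_quotient[OF assms(1)],
        of "\<epsilon> / (2 * pi)" "Arg u / (2 * pi)"] assms(2)
    by (metis divide_pos_pos pi_gt_zero zero_less_mult_iff zero_less_numeral)
  define x where "x = of_int k * \<beta> - 2 * pi * of_int h - Arg u"
  have "\<bar>x\<bar> = 2 * pi * \<bar>of_int k * (\<beta> / (2 * pi)) - of_int h - Arg u / (2 * pi)\<bar>"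
  proof -
    have "x = 2 * pi * (of_int k * (\<beta> / (2 * pi)) - of_int h - Arg u / (2 * pi))"
      by (simp add: x_def right_diff_distrib)
    then show ?thesis by (simp add: abs_mult)
  qed
  also have "\<dots> < \<epsilon>" using close by (simp add: pos_less_divide_eq mult.commute)
  finally have "\<bar>x\<bar> < \<epsilon>" .
  moreover have "cis (of_int k * \<beta>) = u * cis x"
  proof -
    have "u * cis x = cis (of_int k * \<beta> - 2 * pi * of_int h)"
      by (subst u) (simp add: x_def cis_mult)
    also have "\<dots> = cis (of_int k * \<beta>)"
      by (simp add: cis_divide[symmetric] cis_multiple_2pi)
    finally show ?thesis by simp
  qed
  then have "dist (cis (of_int k * \<beta>)) u = cmod (u * (cis x - 1))"
    by (simp add: dist_norm right_diff_distrib)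
  then have "dist (cis (of_int k * \<beta>)) u \<le> \<bar>x\<bar>"
    using norm_cis_minus_one_le[of x] assms(3) by (simp add: norm_mult)
  moreover have "real (nat k) = of_int k" using k by simp
  ultimately show ?thesis by (metis order_le_less_trans)
qed

text \<open>Compactness of the circle: finitely many rotates of a small ball already cover it, so
  the wait \<open>r\<close> is bounded independently of \<open>a\<close>. The gap between two blocks
  thus stays bounded while their length grows.\<close>

lemma irrational_rotation_syndetic:
  assumes "\<beta> \<in> irrational_angles" "0 < \<epsilon>"
  shows "\<exists>\<rho>. \<forall>a::nat. \<exists>r\<le>\<rho>. cmod (cis (- (real (a + r) * \<beta>)) + 1) < \<epsilon>"
proof -
  have "sphere 0 1 \<subseteq> (\<Union>r\<in>(UNIV::nat set). ball (cis (real r * \<beta>)) \<epsilon>)"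
    using irrational_rotation_dense[OF assms] by auto
  then obtain F :: "nat set" where F: "finite F"
    and cover: "sphere 0 1 \<subseteq> (\<Union>r\<in>F. ball (cis (real r * \<beta>)) \<epsilon>)"
    using compactE_image[OF compact_sphere, of "UNIV :: nat set"
        "\<lambda>r. ball (cis (real r * \<beta>)) \<epsilon>" 0 1] by auto
  show ?thesis
  proof (rule exI[of _ "Max F"], rule allI)
    fix a :: nat
    \<comment> \<open>Factoring out \<open>cis (- (real r * \<beta>))\<close> turns the condition
      into closeness of \<open>cis (real r * \<beta>)\<close> to this point.\<close>
    have "- cis (- (real a * \<beta>)) \<in> (\<Union>r\<in>F. ball (cis (real r * \<beta>)) \<epsilon>)"
      using cover by (rule subsetD) simp
    then obtain r where r: "r \<in> F" "dist (cis (real r * \<beta>)) (- cis (- (real a * \<beta>))) < \<epsilon>"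
      by (auto simp del: dist_minus)
    have "cmod (cis (- (real (a + r) * \<beta>)) + 1)
        = cmod (cis (- (real r * \<beta>))) * cmod (cis (- (real a * \<beta>)) + cis (real r * \<beta>))"
      unfolding norm_mult[symmetric] by (simp add: distrib_left cis_mult algebra_simps)
    also have "\<dots> = dist (cis (real r * \<beta>)) (- cis (- (real a * \<beta>)))"
      by (simp add: dist_norm add.commute)
    finally have "cmod (cis (- (real (a + r) * \<beta>)) + 1) < \<epsilon>" using r(2) by (simp only:)
    then show "\<exists>r\<le>Max F. cmod (cis (- (real (a + r) * \<beta>)) + 1) < \<epsilon>"
      using Max_ge[OF F r(1)] by blast
  qed
qed

section \<open>Sums and observable events along a measure-preserving map\<close>

lemma measurable_funpow:
  assumes "S \<in> measurable N N"
  shows "S ^^ n \<in> measurable N N"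
proof (induction n)
  case (Suc n)
  have "S \<circ> S ^^ n \<in> measurable N N" by (rule measurable_comp[OF Suc assms])
  then show ?case by (simp only: funpow.simps)
qed (simp add: id_def)

locale mp_observable = prob_space N for N :: "'b measure" +
  fixes T :: "'b \<Rightarrow> 'b" and v :: "'b \<Rightarrow> complex"
  assumes T_measurable [measurable]: "T \<in> measurable N N"
    and T_invariant: "distr N N T = N"
    and v_integrable: "integrable N v"
begin

text \<open>A \<open>measure\<close> rather than a family of sets, so that measurability of maps
  from and into it can be expressed; only its space and its \<open>sets\<close> matter.\<close>

definition observed :: "nat set \<Rightarrow> 'b measure" where
  "observed K = sigma (space N)
     {(\<lambda>y. v ((T ^^ k) y)) -` C \<inter> space N | k C. k \<in> K \<and> C \<in> sets borel}"

definition W :: "real \<Rightarrow> nat \<Rightarrow> 'b \<Rightarrow> complex" where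
  "W \<beta> n y = (\<Sum>k<n. cis (- (real k * \<beta>)) * v ((T ^^ k) y))"

lemma v_measurable [measurable]: "v \<in> borel_measurable N"
  using v_integrable by simp

lemma funpow_measurable [measurable]: "T ^^ k \<in> measurable N N"
  by (rule measurable_funpow[OF T_measurable])

lemma funpow_in_space: "y \<in> space N \<Longrightarrow> (T ^^ k) y \<in> space N"
  using measurable_space[OF funpow_measurable] .

lemma W_measurable [measurable]: "W \<beta> n \<in> borel_measurable N"
  unfolding W_def by measurable

lemma distr_funpow: "distr N N (T ^^ k) = N"
proof (induction k)
  case 0
  then show ?case by (simp add: distr_id2)
next
  case (Suc k)
  have "distr N N (T ^^ Suc k) = distr (distr N N (T ^^ k)) N T"
    by (simp add: distr_distr)
  then show ?case unfolding Suc T_invariant .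
qed

lemma prob_funpow:
  assumes "A \<in> sets N"
  shows "prob ((T ^^ k) -` A \<inter> space N) = prob A"
  using measure_distr[OF funpow_measurable assms, of k] by (simp add: distr_funpow)

lemma integral_funpow:
  fixes h :: "'b \<Rightarrow> real"
  assumes "h \<in> borel_measurable N"
  shows "(\<integral>y. h ((T ^^ k) y) \<partial>N) = (\<integral>y. h y \<partial>N)"
  using integral_distr[OF funpow_measurable assms, of k] by (simp add: distr_funpow)

lemma integrable_funpow:
  fixes h :: "'b \<Rightarrow> 'c::{banach, second_countable_topology}"
  assumes "integrable N h"
  shows "integrable N (\<lambda>y. h ((T ^^ k) y))"
  using integrable_distr[OF funpow_measurable, of k h] assms by (simp add: distr_funpow)

text \<open>An increment of \<open>W\<close> is again a sum \<open>W\<close>, started later and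
  turned by a rotation. Hence the norms of increments over equally long stretches have the same
  law.\<close>

lemma W_add: "W \<beta> (n + m) y = W \<beta> n y + cis (- (real n * \<beta>)) * W \<beta> m ((T ^^ n) y)"
proof -
  have "(\<Sum>k<n + m. cis (- (real k * \<beta>)) * v ((T ^^ k) y))
      = W \<beta> n y + (\<Sum>k<m. cis (- (real (n + k) * \<beta>)) * v ((T ^^ (n + k)) y))"
    unfolding W_def by (induction m) (simp_all add: ac_simps)
  also have "(\<Sum>k<m. cis (- (real (n + k) * \<beta>)) * v ((T ^^ (n + k)) y))
      = cis (- (real n * \<beta>)) * W \<beta> m ((T ^^ n) y)"
    unfolding W_def sum_distrib_left
  proof (intro sum.cong refl)
    fix k
    have "- (real (n + k) * \<beta>) = - (real n * \<beta>) + - (real k * \<beta>)"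
      by (simp add: algebra_simps)
    then have "cis (- (real (n + k) * \<beta>)) = cis (- (real n * \<beta>)) * cis (- (real k * \<beta>))"
      by (simp only: cis_mult)
    then show "cis (- (real (n + k) * \<beta>)) * v ((T ^^ (n + k)) y)
        = cis (- (real n * \<beta>)) * (cis (- (real k * \<beta>)) * v ((T ^^ k) ((T ^^ n) y)))"
      by (simp add: add.commute[of n] funpow_add)
  qed
  finally show ?thesis by (simp add: W_def)
qed

lemma observed_generators: 
  "{(\<lambda>y. v ((T ^^ k) y)) -` C \<inter> space N | k C. k \<in> K \<and> C \<in> sets borel} \<subseteq> Pow (space N)"
  by auto

lemma space_observed [simp]: "space (observed K) = space N"
  by (simp add: observed_def space_measure_of_conv)

lemma sets_observed: "sets (observed K) =
    sigma_sets (space N) {(\<lambda>y. v ((T ^^ k) y)) -` C \<inter> space N | k C. k \<in> K \<and> C \<in> sets borel}"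
  unfolding observed_def by (rule sets_measure_of[OF observed_generators])

lemma observed_mono: "K \<subseteq> L \<Longrightarrow> sets (observed K) \<subseteq> sets (observed L)"
  unfolding sets_observed by (rule sigma_sets_mono') blast

lemma observed_subset: "sets (observed K) \<subseteq> sets N"
  unfolding sets_observed by (intro sets.sigma_sets_subset) (auto intro!: measurable_sets)

lemma v_observed:
  assumes "k \<in> K"
  shows "(\<lambda>y. v ((T ^^ k) y)) \<in> borel_measurable (observed K)"
proof (rule measurableI)
  fix C :: "complex set" assume "C \<in> sets borel"
  then have "(\<lambda>y. v ((T ^^ k) y)) -` C \<inter> space N \<in> sets (observed K)"
    unfolding sets_observed using assms by (intro sigma_sets.Basic) blast
  then show "(\<lambda>y. v ((T ^^ k) y)) -` C \<inter> space (observed K) \<in> sets (observed K)" by simp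
qed simp

lemma W_observed: "W \<beta> n \<in> borel_measurable (observed {..<n})"
  unfolding W_def
  by (intro borel_measurable_sum borel_measurable_times borel_measurable_const v_observed) simp

lemma observed_shift:
  assumes "A \<in> sets (observed K)"
  shows "(T ^^ j) -` A \<inter> space N \<in> sets (observed ((+) j ` K))"
proof -
  have "T ^^ j \<in> measurable (observed ((+) j ` K)) (observed K)"
    unfolding observed_def[of K]
  proof (rule measurable_measure_of[OF observed_generators])
    show "T ^^ j \<in> space (observed ((+) j ` K)) \<rightarrow> space N"
      using funpow_in_space by auto
    fix D assume "D \<in> {(\<lambda>y. v ((T ^^ k) y)) -` C \<inter> space N | k C. k \<in> K \<and> C \<in> sets borel}"
    then obtain k C where D: "D = (\<lambda>y. v ((T ^^ k) y)) -` C \<inter> space N" "k \<in> K" "C \<in> sets borel"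
      by blast
    have "(T ^^ j) -` D \<inter> space N = (\<lambda>y. v ((T ^^ (j + k)) y)) -` C \<inter> space N"
      using funpow_in_space[of _ j] by (auto simp: D add.commute[of j] funpow_add)
    then show "(T ^^ j) -` D \<inter> space (observed ((+) j ` K)) \<in> sets (observed ((+) j ` K))"
      using measurable_sets[OF v_observed[of "j + k" "(+) j ` K"] D(3)] D(2) by auto
  qed
  from measurable_sets[OF this assms] show ?thesis by simp
qed

end

section \<open>Mixing against an arbitrary event\<close>

text \<open>
  Bessel's inequality for nearly uncorrelated events \<open>F j\<close>: an event \<open>D\<close> can be
  negatively correlated with only few of them.
\<close>

lemma (in prob_space) negatively_correlated_events_bound:
  assumes D: "D \<in> events" and F: "\<And>j. j < K \<Longrightarrow> F j \<in> events"
    and cov: "\<And>i j. i < j \<Longrightarrow> j < K \<Longrightarrow> \<bar>prob (F i \<inter> F j) - prob (F i) * prob (F j)\<bar> \<le> \<delta>"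
    and neg: "\<And>j. j < K \<Longrightarrow> prob (D \<inter> F j) \<le> prob D * prob (F j) - \<epsilon>"
    and "0 \<le> \<epsilon>" "0 \<le> \<delta>"
  shows "(real K * \<epsilon>)\<^sup>2 \<le> real K + (real K)\<^sup>2 * \<delta>"
proof -
  \<comment> \<open>The value minimizing \<open>K + K\<^sup>2 * \<delta> - 2 * c * (K * \<epsilon>)
    + c\<^sup>2\<close>, which bounds the second moment of the sum of all \<open>f j\<close> plus
    \<open>c * d\<close>.\<close>
  define c where "c = real K * \<epsilon>"
  define f where "f j x = (indicator (F j) x :: real) - prob (F j)" for j x
  \<comment> \<open>Centring \<open>f j\<close> alone already makes the mean of
    \<open>d * f j\<close> a covariance, and the uncentred \<open>d\<close> satisfies
    \<open>d\<^sup>2 = d\<close>.\<close>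
  define d where "d x = (indicator D x :: real)" for x
  have [measurable]: "D \<in> events" by fact
  have f_meas: "j < K \<Longrightarrow> f j \<in> borel_measurable M" for j
    unfolding f_def using F by measurable
  have f_bd: "\<bar>f j x\<bar> \<le> 1" for j x
    using prob_le_1[of "F j"] measure_nonneg[of M "F j"] unfolding f_def
    by (cases "x \<in> F j") (simp_all del: prob_le_1 measure_nonneg)
  have int_ff: "integrable M (\<lambda>x. f i x * f j x)" if "i < K" "j < K" for i j
  proof (rule integrable_const_bound[where B = 1])
    show "AE x in M. norm (f i x * f j x) \<le> 1"
      using f_bd by (auto simp: abs_mult intro!: mult_le_one)
  qed (use f_meas that in measurable)
  have int_df: "integrable M (\<lambda>x. d x * f j x)" if "j < K" for j
  proof (rule integrable_const_bound[where B = 1])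
    show "AE x in M. norm (d x * f j x) \<le> 1"
      using f_bd by (auto simp: abs_mult d_def indicator_def)
    show "(\<lambda>x. d x * f j x) \<in> borel_measurable M"
      using f_meas that unfolding d_def by measurable
  qed
  have ind: "(\<integral>x. indicator A x * indicator B x \<partial>M) = prob (A \<inter> B)"
    if "A \<in> events" "B \<in> events" for A B
    using that by (simp add: Bochner_Integration.integral_indicator flip: indicator_inter_arith)
  have int_ind: "integrable M (\<lambda>x. indicator A x * indicator B x :: real)"
    if "A \<in> events" "B \<in> events" for A B
    using that
    by (simp flip: indicator_inter_arith add: integrable_indicator_iff emeasure_eq_measure)
  have int1: "integrable M (\<lambda>x. indicator A x :: real)" if "A \<in> events" for A
    using that by (simp add: integrable_indicator_iff emeasure_eq_measure)
  have int_d: "integrable M d" and E_d: "(\<integral>x. d x \<partial>M) = prob D"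
    using D int1[OF D] by (simp_all add: d_def[abs_def])
  have Eff: "(\<integral>x. f i x * f j x \<partial>M) = prob (F i \<inter> F j) - prob (F i) * prob (F j)"
    if "i < K" "j < K" for i j
  proof -
    have "f i x * f j x = indicator (F i) x * indicator (F j) x
        - prob (F j) * indicator (F i) x - prob (F i) * indicator (F j) x
        + prob (F i) * prob (F j)" for x
      by (simp add: f_def algebra_simps)
    then show ?thesis
      using F that int_ind[of "F i" "F j"] by (simp add: ind int1 prob_space)
  qed
  have Edf: "(\<integral>x. d x * f j x \<partial>M) = prob (D \<inter> F j) - prob D * prob (F j)" if "j < K" for j
  proof -
    have "d x * f j x = indicator D x * indicator (F j) x - prob (F j) * indicator D x" for x
      by (simp add: f_def d_def algebra_simps)
    then show ?thesis
      using F that D int_ind[of D "F j"] by (simp add: ind int1)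
  qed
  have "0 \<le> (\<integral>x. ((\<Sum>j<K. f j x) + c * d x)\<^sup>2 \<partial>M)" by simp
  also have "\<dots> = (\<integral>x. (\<Sum>i<K. \<Sum>j<K. f i x * f j x) + 2 * c * (\<Sum>j<K. d x * f j x)
      + c\<^sup>2 * d x \<partial>M)"
  proof (intro Bochner_Integration.integral_cong refl)
    fix x
    have "(d x)\<^sup>2 = d x" by (simp add: d_def indicator_def)
    then show "((\<Sum>j<K. f j x) + c * d x)\<^sup>2 = (\<Sum>i<K. \<Sum>j<K. f i x * f j x)
        + 2 * c * (\<Sum>j<K. d x * f j x) + c\<^sup>2 * d x"
      by (simp add: power2_sum power_mult_distrib power2_eq_square[of "\<Sum>j<K. f j x"]
          sum_product flip: sum_distrib_left)
  qed
  also have "\<dots> = (\<Sum>i<K. \<Sum>j<K. \<integral>x. f i x * f j x \<partial>M) + 2 * c * (\<Sum>j<K. \<integral>x. d x * f j x \<partial>M)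
      + c\<^sup>2 * prob D"
  proof -
    have I1: "integrable M (\<lambda>x. \<Sum>j<K. f i x * f j x)" if "i < K" for i
      by (rule Bochner_Integration.integrable_sum) (use int_ff that in auto)
    have I2: "integrable M (\<lambda>x. \<Sum>i<K. \<Sum>j<K. f i x * f j x)"
      by (rule Bochner_Integration.integrable_sum) (use I1 in auto)
    have I3: "integrable M (\<lambda>x. \<Sum>j<K. d x * f j x)"
      by (rule Bochner_Integration.integrable_sum) (use int_df in auto)
    have "(\<integral>x. (\<Sum>i<K. \<Sum>j<K. f i x * f j x) \<partial>M) = (\<Sum>i<K. \<Sum>j<K. \<integral>x. f i x * f j x \<partial>M)"
      using I1 int_ff by (simp add: Bochner_Integration.integral_sum)
    moreover have "(\<integral>x. (\<Sum>j<K. d x * f j x) \<partial>M) = (\<Sum>j<K. \<integral>x. d x * f j x \<partial>M)"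
      using int_df by (simp add: Bochner_Integration.integral_sum)
    ultimately show ?thesis using I2 I3 int_d E_d by simp
  qed
  also have "\<dots> \<le> (real K + (real K)\<^sup>2 * \<delta>) + 2 * c * (- c) + c\<^sup>2 * 1"
  proof (intro add_mono mult_left_mono)
    have "(\<integral>x. f i x * f j x \<partial>M) \<le> (if i = j then 1 else 0) + \<delta>" if "i < K" "j < K" for i j
    proof (cases "i = j")
      case True
      have "prob (F i) \<le> 1" "0 \<le> prob (F i) * prob (F i)" by auto
      then have "prob (F i \<inter> F i) - prob (F i) * prob (F i) \<le> 1 + \<delta>"
        unfolding Int_absorb using \<open>0 \<le> \<delta>\<close> by linarith
      then show ?thesis using that True by (simp add: Eff)
    next
      case False
      then have "i < j \<or> j < i" by auto
      then show ?thesis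
        using cov[of i j] cov[of j i] that False
        by (auto simp: Eff Int_commute mult.commute abs_le_iff)
    qed
    then have "(\<Sum>i<K. \<Sum>j<K. \<integral>x. f i x * f j x \<partial>M)
        \<le> (\<Sum>i<K. \<Sum>j<K. (if i = j then 1 else 0) + \<delta>)"
      by (intro sum_mono) auto
    also have "\<dots> = real K + (real K)\<^sup>2 * \<delta>"
      by (simp add: sum.distrib power2_eq_square algebra_simps)
    finally show "(\<Sum>i<K. \<Sum>j<K. \<integral>x. f i x * f j x \<partial>M) \<le> real K + (real K)\<^sup>2 * \<delta>" .
    have "(\<Sum>j<K. \<integral>x. d x * f j x \<partial>M) \<le> (\<Sum>j<K. - \<epsilon>)"
      using neg by (intro sum_mono) (auto simp: Edf algebra_simps)
    then show "(\<Sum>j<K. \<integral>x. d x * f j x \<partial>M) \<le> - c" by (simp add: c_def)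
    show "0 \<le> 2 * c" using \<open>0 \<le> \<epsilon>\<close> by (simp add: c_def)
  qed auto
  finally show ?thesis by (simp add: c_def[symmetric] power2_eq_square)
qed

locale mixing_observable = mp_observable N T v for N :: "'b measure" and T v +
  fixes \<alpha> :: "nat \<Rightarrow> real"
  assumes mixing: "\<And>a g A B. A \<in> sets (observed {..<a}) \<Longrightarrow> B \<in> sets (observed {a + g..}) \<Longrightarrow>
      \<bar>prob (A \<inter> B) - prob A * prob B\<bar> \<le> \<alpha> g"
    and mixing_rate: "\<alpha> \<longlonglongrightarrow> 0"
begin

lemma mixing_rate_small:
  assumes "0 < \<epsilon>"
  obtains g where "\<And>h. g \<le> h \<Longrightarrow> \<alpha> h < \<epsilon>"
  using order_tendstoD(2)[OF mixing_rate assms] unfolding eventually_sequentially by blast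

text \<open>
  The event \<open>B\<close> need not be observable. If the claim failed for all \<open>q\<close>, the violating
  events could be chosen with gaps so large that their images under powers of \<open>T\<close> are
  nearly independent.
\<close>

lemma uniform_mixing:
  assumes B: "B \<in> sets N" and \<epsilon>: "0 < \<epsilon>"
  shows "\<exists>q. \<forall>n\<ge>q. \<forall>E\<in>sets (observed {..<n - q}).
           prob B * prob E - \<epsilon> \<le> prob ((T ^^ n) -` B \<inter> space N \<inter> E)"
proof (rule ccontr)
  assume "\<not> ?thesis"
  then have "\<forall>q. \<exists>n E. q \<le> n \<and> E \<in> sets (observed {..<n - q}) \<and>
      prob ((T ^^ n) -` B \<inter> space N \<inter> E) < prob B * prob E - \<epsilon>"
    by (simp add: not_le) blast
  then obtain nn EE where nn: "\<And>q. q \<le> nn q"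
    and EE: "\<And>q. EE q \<in> sets (observed {..<nn q - q})"
    and viol: "\<And>q. prob ((T ^^ nn q) -` B \<inter> space N \<inter> EE q) < prob B * prob (EE q) - \<epsilon>"
    by metis
  obtain g where g: "\<And>h. g \<le> h \<Longrightarrow> \<alpha> h < \<epsilon>\<^sup>2 / 2"
    using mixing_rate_small[of "\<epsilon>\<^sup>2 / 2"] \<epsilon> by auto
  \<comment> \<open>The free window of length \<open>Q (Suc j)\<close> is long enough to contain the
    whole time span \<open>nn (Q j)\<close> of the preceding violation together with a gap
    \<open>g\<close>.\<close>
  define Q where "Q = rec_nat 0 (\<lambda>_ q. nn q + g)"
  have Q_Suc: "Q (Suc j) = nn (Q j) + g" for j by (simp add: Q_def)
  have gap: "nn (Q i) + g \<le> Q j" if "i < j" for i j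
    using that
  proof (induction j)
    case (Suc j)
    then show ?case
      using nn[of "Q j"] by (cases "i = j") (auto simp: Q_Suc)
  qed simp
  \<comment> \<open>With covariances at most \<open>\<epsilon>\<^sup>2 / 2\<close>, Bessel's
    inequality would force \<open>K * \<epsilon>\<^sup>2 \<le> 2\<close>.\<close>
  obtain K :: nat where K: "2 / \<epsilon>\<^sup>2 < real K" using reals_Archimedean2 by blast
  define m where "m = nn (Q K)"
  \<comment> \<open>Pulling back by \<open>s j\<close> moves every violation to the common time
    \<open>m\<close>, so that all of them concern the same event \<open>D\<close>. Then
    \<open>F j\<close> depends on the times from \<open>m - nn (Q j)\<close> up to, but excluding,
    \<open>m - Q j\<close>; these stretches are separated by gaps \<open>g\<close>, larger
    \<open>j\<close> lying earlier.\<close>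
  define s where "s j = m - nn (Q j)" for j
  have le_m: "nn (Q j) \<le> m" if "j < K" for j
    using gap[OF that] nn[of "Q K"] by (simp add: m_def)
  define F where "F j = (T ^^ s j) -` EE (Q j) \<inter> space N" for j
  define D where "D = (T ^^ m) -` B \<inter> space N"
  have EN: "EE q \<in> sets N" for q using EE observed_subset by blast
  have F_obs: "F j \<in> sets (observed ((+) (s j) ` {..<nn (Q j) - Q j}))" for j
    unfolding F_def by (rule observed_shift[OF EE])
  have FN: "F j \<in> sets N" for j using F_obs observed_subset by blast
  have prob_F: "prob (F j) = prob (EE (Q j))" for j
    unfolding F_def by (rule prob_funpow[OF EN])
  have cov: "\<bar>prob (F i \<inter> F j) - prob (F i) * prob (F j)\<bar> \<le> \<epsilon>\<^sup>2 / 2" if "i < j" "j < K" for i j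
  proof -
    have "F j \<in> sets (observed {..<m - Q j})"
      using F_obs[of j] by (rule observed_mono[THEN subsetD, rotated])
        (use nn[of "Q j"] le_m[OF that(2)] in \<open>auto simp: s_def\<close>)
    moreover have "F i \<in> sets (observed {m - Q j + g..})"
      using F_obs[of i] by (rule observed_mono[THEN subsetD, rotated])
        (use gap[OF that(1)] nn[of "Q j"] le_m[OF that(2)] in \<open>auto simp: s_def\<close>)
    ultimately have "\<bar>prob (F j \<inter> F i) - prob (F j) * prob (F i)\<bar> \<le> \<alpha> g"
      by (rule mixing)
    then show ?thesis using g[of g] by (simp add: Int_commute mult.commute)
  qed
  have neg: "prob (D \<inter> F j) \<le> prob D * prob (F j) - \<epsilon>" if "j < K" for j
  proof -
    have "D \<inter> F j = (T ^^ s j) -` ((T ^^ nn (Q j)) -` B \<inter> space N \<inter> EE (Q j)) \<inter> space N"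
    proof -
      have "m = nn (Q j) + s j" using le_m[OF that] by (simp add: s_def)
      then have "(T ^^ m) y = (T ^^ nn (Q j)) ((T ^^ s j) y)" for y
        by (simp add: funpow_add)
      then show ?thesis unfolding D_def F_def using funpow_in_space[of _ "s j"] by auto
    qed
    then have "prob (D \<inter> F j) = prob ((T ^^ nn (Q j)) -` B \<inter> space N \<inter> EE (Q j))"
      by (simp only:) (rule prob_funpow, use B EN in auto)
    also have "\<dots> \<le> prob B * prob (EE (Q j)) - \<epsilon>" using viol[of "Q j"] by simp
    finally show ?thesis using B by (simp add: prob_F D_def prob_funpow)
  qed
  have "D \<in> sets N" using B by (simp add: D_def)
  from negatively_correlated_events_bound[OF this FN cov neg]
  have "(real K * \<epsilon>)\<^sup>2 \<le> real K + (real K)\<^sup>2 * (\<epsilon>\<^sup>2 / 2)" using \<epsilon> by simp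
  then have "real K * (real K * (\<epsilon>\<^sup>2 / 2)) \<le> real K * 1"
    by (simp add: power_mult_distrib power2_eq_square algebra_simps)
  moreover have "0 < real K"
    using K \<epsilon> by (metis divide_pos_pos order.strict_trans zero_less_numeral zero_less_power)
  ultimately have "real K * (\<epsilon>\<^sup>2 / 2) \<le> 1" by (simp only: mult_le_cancel_left_pos)
  moreover have "2 < real K * \<epsilon>\<^sup>2" using K \<epsilon> by (simp add: pos_divide_less_eq)
  ultimately show False by simp
qed

end

section \<open>Packing of visits\<close>

definition cell :: "real \<Rightarrow> complex \<Rightarrow> int \<times> int" where
  "cell d z = (\<lfloor>Re z / d\<rfloor>, \<lfloor>Im z / d\<rfloor>)"

definition cell_range :: "real \<Rightarrow> real \<Rightarrow> (int \<times> int) set" where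
  "cell_range d R = {- \<lceil>R / d\<rceil>..\<lceil>R / d\<rceil>} \<times> {- \<lceil>R / d\<rceil>..\<lceil>R / d\<rceil>}"

lemma floor_quotient_eq_imp_close:
  fixes x y d :: real
  assumes "0 < d" "\<lfloor>x / d\<rfloor> = \<lfloor>y / d\<rfloor>"
  shows "\<bar>x - y\<bar> < d"
proof -
  have "\<bar>a - b\<bar> < 1" if "k \<le> a" "a < k + 1" "k \<le> b" "b < k + 1" for a b k :: real
    using that by linarith
  moreover have "real_of_int \<lfloor>x / d\<rfloor> = real_of_int \<lfloor>y / d\<rfloor>" using assms(2) by simp
  ultimately have "\<bar>x / d - y / d\<bar> < 1"
    by (metis of_int_floor_le real_of_int_floor_add_one_gt)
  then show ?thesis using assms(1) by (simp add: abs_divide flip: diff_divide_distrib)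
qed

lemma cell_eq_imp_close:
  assumes "0 < d" "cell d z = cell d w"
  shows "cmod (z - w) < 2 * d"
  using cmod_le[of "z - w"] assms floor_quotient_eq_imp_close[of d "Re z" "Re w"]
    floor_quotient_eq_imp_close[of d "Im z" "Im w"]
  by (auto simp: cell_def)

lemma floor_quotient_in_range:
  fixes x d R :: real
  assumes "0 < d" "\<bar>x\<bar> \<le> R"
  shows "\<lfloor>x / d\<rfloor> \<in> {- \<lceil>R / d\<rceil>..\<lceil>R / d\<rceil>}"
proof -
  have "- R \<le> x" "x \<le> R" "0 \<le> d" using assms by linarith+
  then have "x / d \<le> R / d" "(- R) / d \<le> x / d"
    by (simp_all only: divide_right_mono)
  then have "\<lfloor>x / d\<rfloor> \<le> \<lfloor>R / d\<rfloor>" "\<lfloor>- (R / d)\<rfloor> \<le> \<lfloor>x / d\<rfloor>"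
    by (auto intro!: floor_mono)
  moreover have "\<lfloor>R / d\<rfloor> \<le> \<lceil>R / d\<rceil>" by (rule floor_le_ceiling)
  ultimately show ?thesis unfolding floor_minus atLeastAtMost_iff by (blast intro: order_trans)
qed

lemma cell_in_range: "0 < d \<Longrightarrow> cmod z \<le> R \<Longrightarrow> cell d z \<in> cell_range d R"
  unfolding cell_def cell_range_def
  using abs_Re_le_cmod[of z] abs_Im_le_cmod[of z] by (intro SigmaI floor_quotient_in_range) auto

lemma finite_cell_range: "finite (cell_range d R)"
  by (simp add: cell_range_def)

lemma card_cell_range_le:
  assumes "0 < d" "0 \<le> R"
  shows "real (card (cell_range d R)) \<le> (2 * R / d + 3)\<^sup>2"
proof -
  have nn: "0 \<le> R / d" using assms by simp
  then have "real (nat (1 + 2 * \<lceil>R / d\<rceil>)) \<le> 2 * R / d + 3"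
    using ceiling_correct[of "R / d"] by simp
  then have "(real (nat (1 + 2 * \<lceil>R / d\<rceil>)))\<^sup>2 \<le> (2 * R / d + 3)\<^sup>2"
    by (intro power_mono) auto
  moreover have "card {- \<lceil>R / d\<rceil>..\<lceil>R / d\<rceil>} = nat (1 + 2 * \<lceil>R / d\<rceil>)" by simp
  ultimately show ?thesis by (simp add: cell_range_def power2_eq_square card_cartesian_product)
qed

lemma card_cell_range_pos: "0 < d \<Longrightarrow> 0 \<le> R \<Longrightarrow> 0 < card (cell_range d R)"
  using cell_in_range[of d 0 R] finite_cell_range by (auto simp: card_gt_0_iff)

lemma cell_measurable [measurable]: "cell d \<in> measurable borel (count_space UNIV)"
proof -
  have "(\<lambda>z. \<lfloor>Re z / d\<rfloor>) \<in> measurable borel (count_space UNIV)"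
    "(\<lambda>z. \<lfloor>Im z / d\<rfloor>) \<in> measurable borel (count_space UNIV)"
    by measurable
  then show ?thesis unfolding cell_def[abs_def] by measurable
qed

context mp_observable
begin

text \<open>
  The increment between two visits to \<open>B\<close> is an isometric image of the difference of the
  unrotated sums \<open>W\<close>, so the visits of one orbit occupy different cells of a grid.
\<close>

lemma visits_packing:
  assumes \<delta>: "0 < \<delta>"
    and sep: "\<And>n y. 1 \<le> n \<Longrightarrow> y \<in> B \<Longrightarrow> (T ^^ n) y \<in> B \<Longrightarrow> cmod (W \<beta> n y) < \<delta> \<Longrightarrow>
      cmod (cis (real n * \<beta>) - 1) < \<delta> \<Longrightarrow> False"
  shows "\<exists>C>0. \<forall>R\<ge>1. \<forall>I y. finite I \<longrightarrow>
    real (card {t \<in> I. (T ^^ t) y \<in> B \<and> cmod (W \<beta> t y) \<le> R}) \<le> C * R\<^sup>2"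
proof -
  \<comment> \<open>Points in a common cell of side \<open>d\<close> are closer than
    \<open>2 * d\<close>.\<close>
  define d where "d = \<delta> / 2"
  have d: "0 < d" using \<delta> by (simp add: d_def)
  \<comment> \<open>The first factor counts cells in the disc of radius \<open>R\<close>, using
    \<open>2 * R / d + 3 \<le> (2 / d + 3) * R\<close> for \<open>R \<ge> 1\<close>; the second
    counts cells meeting the unit circle.\<close>
  define C where "C = (2 / d + 3)\<^sup>2 * (2 / d + 3)\<^sup>2"
  have "0 < 2 / d + 3" using d by (simp add: add_pos_pos)
  then have "0 < C" by (simp add: C_def)
  moreover have "real (card {t \<in> I. (T ^^ t) y \<in> B \<and> cmod (W \<beta> t y) \<le> R}) \<le> C * R\<^sup>2"
    if "1 \<le> R" "finite I" for R I y
  proof -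
    let ?A = "{t \<in> I. (T ^^ t) y \<in> B \<and> cmod (W \<beta> t y) \<le> R}"
    \<comment> \<open>Two visits sharing both cells differ by an increment near the identity in both
      components, which \<open>sep\<close> excludes.\<close>
    define \<phi> where "\<phi> t = (cell d (W \<beta> t y), cell d (cis (real t * \<beta>)))" for t
    have ne: "\<phi> s \<noteq> \<phi> t" if "s \<in> ?A" "t \<in> ?A" "s < t" for s t
    proof
      assume eq: "\<phi> s = \<phi> t"
      have t: "t = s + (t - s)" using \<open>s < t\<close> by simp
      have f1: "(T ^^ (t - s)) ((T ^^ s) y) = (T ^^ t) y"
        using t by (metis add.commute comp_apply funpow_add)
      have f2: "cmod (W \<beta> (t - s) ((T ^^ s) y)) < \<delta>"
      proof -
        have "W \<beta> t y - W \<beta> s y = cis (- (real s * \<beta>)) * W \<beta> (t - s) ((T ^^ s) y)"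
          using W_add[of \<beta> s "t - s" y] t by simp
        then have "cmod (W \<beta> t y - W \<beta> s y) = cmod (W \<beta> (t - s) ((T ^^ s) y))"
          by (simp add: norm_mult)
        then show ?thesis
          using cell_eq_imp_close[OF d, of "W \<beta> t y" "W \<beta> s y"] eq by (simp add: \<phi>_def d_def)
      qed
      have f3: "cmod (cis (real (t - s) * \<beta>) - 1) < \<delta>"
      proof -
        have "real t * \<beta> = real s * \<beta> + real (t - s) * \<beta>"
          using \<open>s < t\<close> by (simp add: of_nat_diff algebra_simps)
        then have "cis (real t * \<beta>) - cis (real s * \<beta>)
            = cis (real s * \<beta>) * (cis (real (t - s) * \<beta>) - 1)"
          by (simp only: cis_mult[symmetric] right_diff_distrib mult_1_right)
        then have "cmod (cis (real t * \<beta>) - cis (real s * \<beta>))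
            = cmod (cis (real (t - s) * \<beta>) - 1)"
          by (simp only: norm_mult norm_cis mult_1_left)
        then show ?thesis
          using cell_eq_imp_close[OF d, of "cis (real t * \<beta>)" "cis (real s * \<beta>)"] eq
          by (simp add: \<phi>_def d_def)
      qed
      have "1 \<le> t - s" using \<open>s < t\<close> by simp
      moreover have "(T ^^ s) y \<in> B" "(T ^^ (t - s)) ((T ^^ s) y) \<in> B"
        unfolding f1 using that by simp_all
      ultimately show False using f2 f3 by (rule sep)
    qed
    have "inj_on \<phi> ?A"
    proof (rule inj_onI)
      fix s t assume st: "s \<in> ?A" "t \<in> ?A" "\<phi> s = \<phi> t"
      show "s = t"
      proof (rule linorder_cases[of s t])
        show "s < t \<Longrightarrow> s = t" using ne[OF st(1,2)] st(3) by blast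
        show "t < s \<Longrightarrow> s = t" using ne[OF st(2,1)] st(3) by metis
      qed
    qed
    moreover have "\<phi> ` ?A \<subseteq> cell_range d R \<times> cell_range d 1"
      using d by (auto simp: \<phi>_def intro!: cell_in_range)
    ultimately have "card ?A \<le> card (cell_range d R \<times> cell_range d 1)"
      using finite_cell_range by (intro card_inj_on_le[of \<phi>]) auto
    then have "real (card ?A) \<le> real (card (cell_range d R)) * real (card (cell_range d 1))"
      unfolding card_cartesian_product by (simp only: of_nat_mult[symmetric] of_nat_le_iff)
    also have "\<dots> \<le> ((2 / d + 3) * R)\<^sup>2 * (2 / d + 3)\<^sup>2"
    proof (intro mult_mono)
      have "real (card (cell_range d R)) \<le> (2 * R / d + 3)\<^sup>2"
        using card_cell_range_le[OF d, of R] that by simp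
      also have "\<dots> \<le> ((2 / d + 3) * R)\<^sup>2"
      proof (rule power_mono)
        have "(2 / d + 3) * R = 2 * R / d + 3 * R" by (simp add: distrib_right)
        then show "2 * R / d + 3 \<le> (2 / d + 3) * R" using that by linarith
        show "0 \<le> 2 * R / d + 3" using that d by simp
      qed
      finally show "real (card (cell_range d R)) \<le> ((2 / d + 3) * R)\<^sup>2" .
      show "real (card (cell_range d 1)) \<le> (2 / d + 3)\<^sup>2"
        using card_cell_range_le[OF d, of 1] by simp
    qed auto
    also have "\<dots> = C * R\<^sup>2" by (simp add: C_def power_mult_distrib)
    finally show ?thesis .
  qed
  ultimately show ?thesis by blast
qed

section \<open>Markov bounds and the expected number of visits\<close>

lemma W_integrable: "integrable N (W \<beta> n)"
  unfolding W_def[abs_def]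
  by (intro Bochner_Integration.integrable_sum integrable_mult_right integrable_funpow v_integrable)

lemma expectation_norm_W_le: "(\<integral>y. cmod (W \<beta> n y) \<partial>N) \<le> real n * (\<integral>y. cmod (v y) \<partial>N)"
proof -
  have int: "integrable N (\<lambda>y. cmod (v ((T ^^ k) y)))" for k
    by (intro integrable_norm integrable_funpow v_integrable)
  have "(\<integral>y. cmod (W \<beta> n y) \<partial>N) \<le> (\<integral>y. (\<Sum>k<n. cmod (v ((T ^^ k) y))) \<partial>N)"
  proof (rule integral_mono)
    show "cmod (W \<beta> n y) \<le> (\<Sum>k<n. cmod (v ((T ^^ k) y)))" for y
      unfolding W_def by (rule order_trans[OF norm_sum]) (simp add: norm_mult)
  qed (use W_integrable int in auto)
  also have "\<dots> = (\<Sum>k<n. \<integral>y. cmod (v ((T ^^ k) y)) \<partial>N)"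
    using int by (simp add: Bochner_Integration.integral_sum)
  also have "\<dots> = real n * (\<integral>y. cmod (v y) \<partial>N)"
    by (simp add: integral_funpow[of "\<lambda>y. cmod (v y)"])
  finally show ?thesis .
qed

lemma prob_norm_W_ge:
  assumes "0 < t"
  shows "prob {y \<in> space N. t \<le> cmod (W \<beta> n y)} \<le> (\<integral>y. cmod (W \<beta> n y) \<partial>N) / t"
  using assms W_integrable
  by (intro integral_Markov_inequality_measure[where A = "space N"]) auto

text \<open>The sum of the probabilities is the expected number of visits, and the packing bound
  holds on every single orbit.\<close>

lemma sum_visit_probabilities_le:
  assumes B: "B \<in> sets N" and I: "finite I"
    and pack: "\<And>y. real (card {t \<in> I. (T ^^ t) y \<in> B \<and> cmod (W \<beta> t y) \<le> R}) \<le> b"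
  shows "(\<Sum>t\<in>I. prob ((T ^^ t) -` B \<inter> space N \<inter> {y \<in> space N. cmod (W \<beta> t y) \<le> R})) \<le> b"
proof -
  define S where "S t = (T ^^ t) -` B \<inter> space N \<inter> {y \<in> space N. cmod (W \<beta> t y) \<le> R}" for t
  have S: "S t \<in> sets N" for t
    using measurable_sets[OF funpow_measurable B, of t] unfolding S_def by measurable
  have int: "integrable N (indicator (S t) :: _ \<Rightarrow> real)" for t
    using S by (simp add: integrable_indicator_iff emeasure_eq_measure)
  have "(\<Sum>t\<in>I. prob (S t)) = (\<integral>y. (\<Sum>t\<in>I. indicator (S t) y) \<partial>N)"
    using S int by (subst Bochner_Integration.integral_sum) auto
  also have "\<dots> \<le> (\<integral>y. b \<partial>N)"
  proof (rule integral_mono)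
    fix y assume y: "y \<in> space N"
    have "(\<Sum>t\<in>I. indicator (S t) y) = real (card {t \<in> I. y \<in> S t})"
      using I by (simp add: indicator_def sum.If_cases Int_def)
    also have "\<dots> \<le> b" using pack[of y] y by (simp add: S_def)
    finally show "(\<Sum>t\<in>I. indicator (S t) y) \<le> b" .
  qed (use int in auto)
  finally show ?thesis by (simp add: S_def prob_space)
qed

end

section \<open>Lower bound for return probabilities\<close>

text \<open>Base 4 because \<open>2 ^ k \<le> sqrt m\<close> means \<open>4 ^ k \<le> m\<close>,
  that is \<open>k \<le> lg m\<close>.\<close>

lemma floor_log4_exists:
  "\<exists>lg :: nat \<Rightarrow> nat. \<forall>m\<ge>1. 4 ^ lg m \<le> m \<and> m < 4 ^ (lg m + 1)"
proof -
  have "\<forall>m::nat. \<exists>l. 1 \<le> m \<longrightarrow> 4 ^ l \<le> m \<and> m < 4 ^ (l + 1)"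
    using ex_power_ivl1[of 4] by auto
  from choice[OF this] show ?thesis by blast
qed

context mixing_observable
begin

text \<open>By Markov's inequality at least half of the mass lies in the cells of
  \<open>cell_range d t\<close>, so by Cauchy-Schwarz the squares of the cell probabilities sum to
  at least \<open>1 / (4 * card)\<close>. Replacing each square by the probability that both blocks
  hit the cell costs \<epsilon> per cell. The event stays observable, so that mixing against
  \<open>B\<close> can be applied to it.\<close>

lemma prob_both_in_same_cell:
  assumes gap: "\<alpha> r \<le> \<epsilon>" and t: "0 < t" and d: "0 < d"
    and half: "(\<integral>y. cmod (W \<beta> a y) \<partial>N) / t \<le> 1 / 2"
  shows "\<exists>E\<in>sets (observed {..<2 * a + r}).
    1 / (4 * real (card (cell_range d t))) - real (card (cell_range d t)) * \<epsilon> \<le> prob E \<and>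
    (\<forall>y\<in>E. y \<in> space N \<and> cmod (W \<beta> a ((T ^^ (a + r)) y)) \<le> t \<and>
       cell d (W \<beta> a y) = cell d (W \<beta> a ((T ^^ (a + r)) y)))"
proof -
  define I where "I = cell_range d t"
  have fin: "finite I" by (simp add: I_def finite_cell_range)
  have card_I: "0 < real (card I)" using card_cell_range_pos[OF d, of t] t by (simp add: I_def)
  define Q where "Q i = {z. cmod z \<le> t \<and> cell d z = i}" for i
  define A where "A i = W \<beta> a -` Q i \<inter> space N" for i
  define A' where "A' i = (T ^^ (a + r)) -` A i \<inter> space N" for i
  define E where "E = (\<Union>i\<in>I. A i \<inter> A' i)"
  have Q: "Q i \<in> sets borel" for i unfolding Q_def by measurable
  have A: "A i \<in> sets (observed {..<a})" for i
    using measurable_sets[OF W_observed Q, of \<beta> a i] by (simp add: A_def)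
  have A'': "A' i \<in> sets (observed ((+) (a + r) ` {..<a}))" for i
    unfolding A'_def by (rule observed_shift[OF A])
  have A': "A' i \<in> sets (observed {a + r..})" for i
    using A''[of i] by (rule observed_mono[THEN subsetD, rotated]) auto
  have AN: "A i \<in> sets N" "A' i \<in> sets N" for i
    using A A' observed_subset by blast+
  have "E \<in> sets (observed {..<2 * a + r})"
    unfolding E_def
  proof (intro sets.finite_UN fin sets.Int)
    show "A i \<in> sets (observed {..<2 * a + r})" for i
      using A[of i] by (rule observed_mono[THEN subsetD, rotated]) auto
    show "A' i \<in> sets (observed {..<2 * a + r})" for i
      using A''[of i] by (rule observed_mono[THEN subsetD, rotated]) auto
  qed
  moreover have "y \<in> space N \<and> cmod (W \<beta> a ((T ^^ (a + r)) y)) \<le> t \<and>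
      cell d (W \<beta> a y) = cell d (W \<beta> a ((T ^^ (a + r)) y))" if "y \<in> E" for y
    using that by (auto simp: E_def A_def A'_def Q_def)
  moreover have "1 / (4 * real (card I)) - real (card I) * \<epsilon> \<le> prob E"
  proof -
    have "1 / 2 \<le> (\<Sum>i\<in>I. prob (A i))"
    proof -
      have "prob (space N - {y \<in> space N. t \<le> cmod (W \<beta> a y)})
          = 1 - prob {y \<in> space N. t \<le> cmod (W \<beta> a y)}"
        by (rule prob_compl) measurable
      then have "1 / 2 \<le> prob (space N - {y \<in> space N. t \<le> cmod (W \<beta> a y)})"
        using prob_norm_W_ge[OF t, of \<beta> a] half by linarith
      also have "\<dots> \<le> prob (\<Union>i\<in>I. A i)"
      proof (rule finite_measure_mono)
        show "space N - {y \<in> space N. t \<le> cmod (W \<beta> a y)} \<subseteq> (\<Union>i\<in>I. A i)"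
          using cell_in_range[OF d] by (auto simp: A_def Q_def I_def)
      qed (use AN fin in auto)
      also have "\<dots> \<le> (\<Sum>i\<in>I. prob (A i))"
        using AN fin by (intro finite_measure_subadditive_finite) auto
      finally show ?thesis .
    qed
    then have "(1 / 2)\<^sup>2 \<le> (\<Sum>i\<in>I. prob (A i))\<^sup>2" by (intro power_mono) auto
    also have "\<dots> \<le> (\<Sum>i\<in>I. (prob (A i))\<^sup>2) * real (card I)"
      by (rule sum_squared_le_sum_of_squares)
    finally have "1 / (4 * real (card I)) \<le> (\<Sum>i\<in>I. (prob (A i))\<^sup>2)"
      using card_I by (simp add: divide_simps power2_eq_square mult.commute)
    also have "\<dots> \<le> (\<Sum>i\<in>I. prob (A i \<inter> A' i) + \<epsilon>)"
    proof (rule sum_mono)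
      fix i
      have "\<bar>prob (A i \<inter> A' i) - prob (A i) * prob (A' i)\<bar> \<le> \<alpha> r"
        by (rule mixing[OF A A'])
      moreover have "prob (A' i) = prob (A i)"
        unfolding A'_def by (rule prob_funpow[OF AN(1)])
      ultimately show "(prob (A i))\<^sup>2 \<le> prob (A i \<inter> A' i) + \<epsilon>"
        using gap by (simp add: power2_eq_square abs_le_iff)
    qed
    also have "\<dots> = prob E + real (card I) * \<epsilon>"
    proof -
      have "prob E = (\<Sum>i\<in>I. prob (A i \<inter> A' i))"
        unfolding E_def
        by (rule finite_measure_finite_Union)
          (use AN fin in \<open>auto simp: disjoint_family_on_def A_def Q_def\<close>)
      then show ?thesis by (simp add: sum.distrib)
    qed
    finally show ?thesis by simp
  qed
  ultimately show ?thesis unfolding I_def by blast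
qed

text \<open>The tail of length \<open>l\<close> compensates for the varying gap \<open>r\<close>, so
  that the total length can be fixed in advance.\<close>

lemma W_split_two_blocks:
  "W \<beta> (a + (r + (a + l))) y =
     (W \<beta> a y + cis (- (real (a + r) * \<beta>)) * W \<beta> a ((T ^^ (a + r)) y))
     + cis (- (real a * \<beta>)) * W \<beta> r ((T ^^ a) y)
     + cis (- (real (2 * a + r) * \<beta>)) * W \<beta> l ((T ^^ (2 * a + r)) y)"
proof -
  have 1: "- (real (a + r) * \<beta>) = - (real a * \<beta>) + - (real r * \<beta>)"
    "- (real (2 * a + r) * \<beta>) = - (real a * \<beta>) + (- (real r * \<beta>) + - (real a * \<beta>))"
    by (simp_all add: algebra_simps)
  have 2: "(T ^^ (a + r)) y = (T ^^ r) ((T ^^ a) y)"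
    "(T ^^ (2 * a + r)) y = (T ^^ a) ((T ^^ r) ((T ^^ a) y))"
  proof -
    have "a + r = r + a" "2 * a + r = a + (r + a)" by simp_all
    then show "(T ^^ (a + r)) y = (T ^^ r) ((T ^^ a) y)"
      "(T ^^ (2 * a + r)) y = (T ^^ a) ((T ^^ r) ((T ^^ a) y))"
      by (simp_all only: funpow_add comp_apply)
  qed
  show ?thesis
    unfolding W_add 1 2 cis_mult[symmetric] by (simp add: distrib_left mult.assoc)
qed

text \<open>
  \<open>W \<beta> (2 * n)\<close> is made small by two blocks of length \<open>n - p\<close> which are nearly independent
  and identically distributed, hence fall into the same cell with probability at least of
  the order \<open>R\<^sup>2 / n\<close>; the gap \<open>r\<close> between them turns the second one by almost \<open>\<pi>\<close>.
\<close>

lemma return_event: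
  assumes \<beta>: "\<beta> \<in> irrational_angles" and C: "0 < C"
  shows "\<exists>c>0. \<forall>\<eta>>0. \<forall>\<epsilon>>0. \<forall>q. \<exists>n0. \<forall>n\<ge>n0. \<forall>R.
    (\<integral>y. cmod (W \<beta> n y) \<partial>N) \<le> C * sqrt (real n) \<longrightarrow> \<eta> * sqrt (real n) \<le> R \<longrightarrow>
    R \<le> sqrt (real n) \<longrightarrow>
    (\<exists>E\<in>sets (observed {..<2 * n - q}). \<exists>Z\<in>sets N. c * R\<^sup>2 / real n \<le> prob E \<and> prob Z \<le> \<epsilon> \<and>
       (\<forall>y\<in>E - Z. cmod (W \<beta> (2 * n) y) \<le> R))"
proof -
  \<comment> \<open>Half of \<open>t = L * sqrt n\<close> is \<open>C * sqrt n\<close> for the full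
    block plus \<open>sqrt n\<close> for the \<open>p\<close> terms cut off, as Markov's inequality
    with probability \<open>1 / 2\<close> demands.\<close>
  define L where "L = 2 * (C + 1)"
  have L: "0 < L" using C by (simp add: L_def)
  \<comment> \<open>With \<open>t = L * sqrt n\<close>, \<open>d = R / 8\<close> and
    \<open>R \<le> sqrt n\<close> the number of cells is at most
    \<open>c1 * n / R\<^sup>2\<close>.\<close>
  define c1 where "c1 = (16 * L + 3)\<^sup>2"
  have c1: "0 < c1" using L by (simp add: c1_def)
  define V where "V = (\<integral>y. cmod (v y) \<partial>N)"
  have V: "0 \<le> V" by (simp add: V_def)
  have main: "\<exists>n0. \<forall>n\<ge>n0. \<forall>R.
    (\<integral>y. cmod (W \<beta> n y) \<partial>N) \<le> C * sqrt (real n) \<longrightarrow> \<eta> * sqrt (real n) \<le> R \<longrightarrow>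
    R \<le> sqrt (real n) \<longrightarrow>
    (\<exists>E\<in>sets (observed {..<2 * n - q}). \<exists>Z\<in>sets N. (1 / (8 * c1)) * R\<^sup>2 / real n \<le> prob E \<and>
       prob Z \<le> \<epsilon> \<and> (\<forall>y\<in>E - Z. cmod (W \<beta> (2 * n) y) \<le> R))"
    if \<eta>: "0 < \<eta>" and \<epsilon>: "0 < \<epsilon>" for \<eta> \<epsilon> :: real and q :: nat
  proof -
    \<comment> \<open>Put \<open>x = R\<^sup>2 / n\<close>, so
      \<open>x \<ge> \<eta>\<^sup>2\<close>. There are at most \<open>c1 / x\<close> cells, so the
      mixing error is at most \<open>x / (8 * c1)\<close>, half of the main term
      \<open>x / (4 * c1)\<close>.\<close>
    define \<epsilon>1 where "\<epsilon>1 = \<eta>\<^sup>2 * \<eta>\<^sup>2 / (8 * c1 * c1)"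
    have \<epsilon>1: "0 < \<epsilon>1" using \<eta> c1 by (simp add: \<epsilon>1_def)
    obtain g where g: "\<And>h. g \<le> h \<Longrightarrow> \<alpha> h < \<epsilon>1" using mixing_rate_small[OF \<epsilon>1] by blast
    \<comment> \<open>This precision keeps the rotation error on a block of norm at most
      \<open>t\<close> below \<open>\<eta> * sqrt n / 4\<close>, hence below
      \<open>R / 4\<close>.\<close>
    have "0 < \<eta> / (4 * L)" using \<eta> L by simp
    from irrational_rotation_syndetic[OF \<beta> this] obtain \<rho> where
      \<rho>: "\<And>a::nat. \<exists>r\<le>\<rho>. cmod (cis (- (real (a + r) * \<beta>)) + 1) < \<eta> / (4 * L)" by blast
    \<comment> \<open>Shortening both blocks by \<open>p\<close> frees \<open>2 * p\<close> steps:
      enough for a gap of at most \<open>g + \<rho>\<close> and a tail of at least \<open>q\<close>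
      steps.\<close>
    define p where "p = g + \<rho> + q"
    \<comment> \<open>From \<open>n1\<close> on, the \<open>p\<close> terms cut off have mean norm
      at most \<open>sqrt n\<close>; from \<open>n2\<close> on, gap and tail together reach
      \<open>R / 4\<close> with probability at most \<epsilon>.\<close>
    obtain n1 :: nat where n1: "(real p * V)\<^sup>2 \<le> real n1" using real_arch_simple by blast
    obtain n2 :: nat where n2: "(8 * real p * V / (\<eta> * \<epsilon>))\<^sup>2 \<le> real n2"
      using real_arch_simple by blast
    show ?thesis
    proof (intro exI[of _ "p + n1 + n2 + 1"] allI impI)
      fix n :: nat and R :: real
      assume n: "p + n1 + n2 + 1 \<le> n"
        and good: "(\<integral>y. cmod (W \<beta> n y) \<partial>N) \<le> C * sqrt (real n)"
        and R1: "\<eta> * sqrt (real n) \<le> R" and R2: "R \<le> sqrt (real n)"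
      have sn: "0 < sqrt (real n)" using n by simp
      then have R: "0 < R" using R1 \<eta> by (meson less_le_trans mult_pos_pos)
      have pV: "real p * V \<le> sqrt (real n)"
        using n1 n by (intro real_le_rsqrt) linarith
      have pV2: "8 * real p * V / (\<eta> * \<epsilon>) \<le> sqrt (real n)"
        using n2 n by (intro real_le_rsqrt) linarith
      define a where "a = n - p"
      \<comment> \<open>Searching from \<open>a + g\<close> onwards makes the gap
        \<open>g + r'\<close> long enough for mixing as well as suitable for the rotation.\<close>
      obtain r' where r': "r' \<le> \<rho>" "cmod (cis (- (real (a + g + r') * \<beta>)) + 1) < \<eta> / (4 * L)"
        using \<rho>[of "a + g"] by blast
      define r where "r = g + r'"
      define l where "l = 2 * p - r"
      have lens: "2 * n = a + (r + (a + l))" "2 * a + r \<le> 2 * n - q" "r + l = 2 * p" "g \<le> r"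
        using n r'(1) by (auto simp: a_def l_def r_def p_def)
      have rot: "cmod (cis (- (real (a + r) * \<beta>)) + 1) < \<eta> / (4 * L)"
        using r'(2) by (simp add: r_def add.assoc)
      define t where "t = L * sqrt (real n)"
      have t: "0 < t" using L sn by (simp add: t_def)
      \<comment> \<open>The radius \<open>R\<close> is spent in quarters: cell diameter, rotation
        error, gap, tail.\<close>
      define d where "d = R / 8"
      have d: "0 < d" using R by (simp add: d_def)
      have "(\<integral>y. cmod (W \<beta> a y) \<partial>N) / t \<le> 1 / 2"
      proof -
        have "(\<integral>y. cmod (W \<beta> a y) \<partial>N) \<le> (\<integral>y. cmod (W \<beta> n y) + cmod (W \<beta> p ((T ^^ a) y)) \<partial>N)"
        proof (rule integral_mono)
          fix y
          have "n = a + p" using n by (simp add: a_def)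
          then have "W \<beta> a y = W \<beta> n y - cis (- (real a * \<beta>)) * W \<beta> p ((T ^^ a) y)"
            by (simp add: W_add)
          then show "cmod (W \<beta> a y) \<le> cmod (W \<beta> n y) + cmod (W \<beta> p ((T ^^ a) y))"
            by (metis norm_triangle_ineq4 norm_mult norm_cis mult_1)
        qed (auto intro!: integrable_norm W_integrable integrable_funpow Bochner_Integration.integrable_add)
        also have "\<dots> = (\<integral>y. cmod (W \<beta> n y) \<partial>N) + (\<integral>y. cmod (W \<beta> p y) \<partial>N)"
          using integral_funpow[of "\<lambda>y. cmod (W \<beta> p y)" a]
          by (subst Bochner_Integration.integral_add)
            (auto intro!: integrable_norm W_integrable integrable_funpow)
        also have "\<dots> \<le> C * sqrt (real n) + sqrt (real n)"
          using good expectation_norm_W_le[of \<beta> p] pV by (simp add: V_def)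
        also have "\<dots> = t / 2" by (simp add: t_def L_def algebra_simps)
        finally show ?thesis using t by (simp add: divide_simps)
      qed
      from prob_both_in_same_cell[OF less_imp_le[OF g[OF lens(4)]] t d this]
      obtain E where E: "E \<in> sets (observed {..<2 * a + r})"
        and prob_E: "1 / (4 * real (card (cell_range d t))) - real (card (cell_range d t)) * \<epsilon>1 \<le> prob E"
        and E_prop: "\<And>y. y \<in> E \<Longrightarrow> y \<in> space N \<and> cmod (W \<beta> a ((T ^^ (a + r)) y)) \<le> t \<and>
          cell d (W \<beta> a y) = cell d (W \<beta> a ((T ^^ (a + r)) y))"
        by blast
      \<comment> \<open>The tail involves the last \<open>q\<close> times, so its size cannot be
        controlled inside \<open>E\<close>, which has to be observable before them; large values are
        removed as an event of small probability.\<close>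
      define Z1 where "Z1 = (T ^^ a) -` {y \<in> space N. R / 4 \<le> cmod (W \<beta> r y)} \<inter> space N"
      define Z2 where "Z2 = (T ^^ (2 * a + r)) -` {y \<in> space N. R / 4 \<le> cmod (W \<beta> l y)} \<inter> space N"
      have Z_sets: "Z1 \<in> sets N" "Z2 \<in> sets N" unfolding Z1_def Z2_def by measurable
      have "prob Z1 \<le> real r * V / (R / 4)"
      proof -
        have "prob Z1 = prob {y \<in> space N. R / 4 \<le> cmod (W \<beta> r y)}"
          unfolding Z1_def by (rule prob_funpow) measurable
        also have "\<dots> \<le> (\<integral>y. cmod (W \<beta> r y) \<partial>N) / (R / 4)"
          using R by (intro prob_norm_W_ge) simp
        also have "\<dots> \<le> real r * V / (R / 4)"
          using R expectation_norm_W_le[of \<beta> r] by (intro divide_right_mono) (auto simp: V_def)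
        finally show ?thesis .
      qed
      moreover have "prob Z2 \<le> real l * V / (R / 4)"
      proof -
        have "prob Z2 = prob {y \<in> space N. R / 4 \<le> cmod (W \<beta> l y)}"
          unfolding Z2_def by (rule prob_funpow) measurable
        also have "\<dots> \<le> (\<integral>y. cmod (W \<beta> l y) \<partial>N) / (R / 4)"
          using R by (intro prob_norm_W_ge) simp
        also have "\<dots> \<le> real l * V / (R / 4)"
          using R expectation_norm_W_le[of \<beta> l] by (intro divide_right_mono) (auto simp: V_def)
        finally show ?thesis .
      qed
      moreover have "prob (Z1 \<union> Z2) \<le> prob Z1 + prob Z2"
        using Z_sets by (intro measure_Un_le) auto
      ultimately have "prob (Z1 \<union> Z2) \<le> (real r + real l) * V / (R / 4)"
        by (simp add: distrib_right add_divide_distrib)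
      also have "real r + real l = 2 * real p"
        using lens(3) by (metis of_nat_add of_nat_mult of_nat_numeral)
      also have "2 * real p * V / (R / 4) \<le> \<epsilon>"
      proof -
        have "8 * real p * V \<le> (\<eta> * \<epsilon>) * sqrt (real n)"
          using pV2 \<eta> \<epsilon> by (simp add: pos_divide_le_eq mult.commute)
        also have "\<dots> \<le> \<epsilon> * R" using R1 \<epsilon> by (simp add: mult.commute mult.left_commute)
        finally show ?thesis using R by (simp add: divide_simps)
      qed
      finally have prob_Z: "prob (Z1 \<union> Z2) \<le> \<epsilon>" .
      have small: "cmod (W \<beta> (2 * n) y) \<le> R" if y: "y \<in> E - (Z1 \<union> Z2)" for y
      proof -
        define z where "z = W \<beta> a ((T ^^ (a + r)) y)"
        define e where "e = cis (- (real (a + r) * \<beta>))"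
        have yE: "y \<in> space N" "cmod z \<le> t" "cell d (W \<beta> a y) = cell d z"
          using E_prop[of y] y by (auto simp: z_def)
        have "cmod (W \<beta> a y + e * z) \<le> cmod (W \<beta> a y - z) + cmod ((e + 1) * z)"
          using norm_triangle_ineq[of "W \<beta> a y - z" "(e + 1) * z"] by (simp add: algebra_simps)
        also have "\<dots> \<le> R / 4 + R / 4"
        proof (rule add_mono)
          show "cmod (W \<beta> a y - z) \<le> R / 4"
            using cell_eq_imp_close[OF d yE(3)] by (simp add: d_def)
          have "cmod ((e + 1) * z) \<le> \<eta> / (4 * L) * t"
            using rot yE(2) \<eta> L unfolding norm_mult e_def by (intro mult_mono) auto
          also have "\<dots> \<le> R / 4" using R1 L by (simp add: t_def)
          finally show "cmod ((e + 1) * z) \<le> R / 4" .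
        qed
        finally have 1: "cmod (W \<beta> a y + e * z) \<le> R / 2" by simp
        have 2: "cmod (W \<beta> r ((T ^^ a) y)) \<le> R / 4"
          "cmod (W \<beta> l ((T ^^ (2 * a + r)) y)) \<le> R / 4"
          using y yE(1) funpow_in_space[OF yE(1)] by (auto simp: Z1_def Z2_def)
        have tri: "cmod (u + w + x) \<le> cmod u + cmod w + cmod x" for u w x
          using norm_triangle_ineq[of "u + w" x] norm_triangle_ineq[of u w] by linarith
        have "cmod (W \<beta> (2 * n) y) \<le> cmod (W \<beta> a y + e * z) + cmod (W \<beta> r ((T ^^ a) y))
            + cmod (W \<beta> l ((T ^^ (2 * a + r)) y))"
          unfolding lens(1) W_split_two_blocks z_def[symmetric] e_def[symmetric]
          using tri[of "W \<beta> a y + e * z" "cis (- (real a * \<beta>)) * W \<beta> r ((T ^^ a) y)"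
              "cis (- (real (2 * a + r) * \<beta>)) * W \<beta> l ((T ^^ (2 * a + r)) y)"]
          by (simp only: norm_mult norm_cis mult_1)
        then show ?thesis using 1 2 by simp
      qed
      have "1 / (8 * c1) * R\<^sup>2 / real n \<le> prob E"
      proof -
        define m where "m = real (card (cell_range d t))"
        define x where "x = R\<^sup>2 / real n"
        have n0: "0 < real n" using n by simp
        have x: "0 < x" using R n0 by (simp add: x_def)
        have m0: "0 < m" using card_cell_range_pos[OF d, of t] t by (simp add: m_def)
        have "m \<le> (2 * t / d + 3)\<^sup>2"
          unfolding m_def using card_cell_range_le[OF d, of t] t by simp
        also have "\<dots> \<le> ((16 * L + 3) * (sqrt (real n) / R))\<^sup>2"
        proof (rule power_mono)
          have "1 \<le> sqrt (real n) / R" using R R2 by simp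
          moreover have "2 * t / d = 16 * L * (sqrt (real n) / R)"
            by (simp add: t_def d_def)
          ultimately show "2 * t / d + 3 \<le> (16 * L + 3) * (sqrt (real n) / R)"
            unfolding distrib_right by linarith
          show "0 \<le> 2 * t / d + 3" using t d by simp
        qed
        also have "\<dots> = c1 / x"
          using n0 by (simp add: c1_def x_def power_mult_distrib power_divide)
        finally have mx: "m \<le> c1 / x" .
        have \<eta>x: "\<eta>\<^sup>2 \<le> x"
        proof -
          have "(\<eta> * sqrt (real n))\<^sup>2 \<le> R\<^sup>2" using R1 \<eta> by (intro power_mono) auto
          then show ?thesis using n0 by (simp add: x_def power_mult_distrib pos_le_divide_eq)
        qed
        have "x / (4 * c1) \<le> 1 / (4 * m)"
          using mx m0 x c1 by (simp add: field_simps)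
        moreover have "m * \<epsilon>1 \<le> x / (8 * c1)"
        proof -
          have "m * \<epsilon>1 \<le> c1 / x * \<epsilon>1" using mx \<epsilon>1 by (intro mult_right_mono) auto
          also have "\<dots> \<le> c1 / x * (x * x / (8 * c1 * c1))"
            unfolding \<epsilon>1_def using \<eta>x x c1
            by (intro mult_left_mono divide_right_mono mult_mono) auto
          also have "\<dots> = x / (8 * c1)" using x c1 by simp
          finally show ?thesis .
        qed
        ultimately have "x / (4 * c1) - x / (8 * c1) \<le> prob E"
          using prob_E unfolding m_def[symmetric] by linarith
        then show ?thesis by (simp add: x_def)
      qed
      moreover have "E \<in> sets (observed {..<2 * n - q})"
        using E by (rule observed_mono[THEN subsetD, rotated]) (use lens(2) in auto)
      ultimately show "\<exists>E\<in>sets (observed {..<2 * n - q}). \<exists>Z\<in>sets N.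
          (1 / (8 * c1)) * R\<^sup>2 / real n \<le> prob E \<and> prob Z \<le> \<epsilon> \<and>
          (\<forall>y\<in>E - Z. cmod (W \<beta> (2 * n) y) \<le> R)"
        using prob_Z small Z_sets by (intro bexI[of _ E] bexI[of _ "Z1 \<union> Z2"]) auto
    qed
  qed
  show ?thesis
    by (rule exI[of _ "1 / (8 * c1)"]) (use c1 main in auto)
qed

text \<open>The return event ends \<open>q\<close> steps before time \<open>2 * n\<close>, so
  hitting \<open>B\<close> at that time is almost not negatively correlated with it. Only the
  endpoint is placed in \<open>B\<close>, since packing compares visits with one another. The
  constant \<open>c\<close> precedes \<eta>: later \<open>\<eta> = 1 / 2 ^ J\<close>, with
  \<open>J\<close> depending on \<open>c\<close>.\<close>

lemma return_probability_lower_bound: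
  assumes \<beta>: "\<beta> \<in> irrational_angles" and C: "0 < C" and B: "B \<in> sets N" "0 < prob B"
  shows "\<exists>c>0. \<forall>\<eta>>0. \<exists>n0. \<forall>n\<ge>n0. \<forall>R.
    (\<integral>y. cmod (W \<beta> n y) \<partial>N) \<le> C * sqrt (real n) \<longrightarrow> \<eta> * sqrt (real n) \<le> R \<longrightarrow>
    R \<le> sqrt (real n) \<longrightarrow>
    c * R\<^sup>2 / real n \<le> prob ((T ^^ (2 * n)) -` B \<inter> space N \<inter> {y \<in> space N. cmod (W \<beta> (2 * n) y) \<le> R})"
proof -
  obtain c where c: "0 < c" and ret: "\<forall>\<eta>>0. \<forall>\<epsilon>>0. \<forall>q. \<exists>n0. \<forall>n\<ge>n0. \<forall>R.
    (\<integral>y. cmod (W \<beta> n y) \<partial>N) \<le> C * sqrt (real n) \<longrightarrow> \<eta> * sqrt (real n) \<le> R \<longrightarrow>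
    R \<le> sqrt (real n) \<longrightarrow>
    (\<exists>E\<in>sets (observed {..<2 * n - q}). \<exists>Z\<in>sets N. c * R\<^sup>2 / real n \<le> prob E \<and> prob Z \<le> \<epsilon> \<and>
       (\<forall>y\<in>E - Z. cmod (W \<beta> (2 * n) y) \<le> R))"
    using return_event[OF \<beta> C] by (elim exE conjE) (rule that)
  define c' where "c' = prob B * c / 2"
  have main: "\<exists>n0. \<forall>n\<ge>n0. \<forall>R.
    (\<integral>y. cmod (W \<beta> n y) \<partial>N) \<le> C * sqrt (real n) \<longrightarrow> \<eta> * sqrt (real n) \<le> R \<longrightarrow>
    R \<le> sqrt (real n) \<longrightarrow>
    c' * R\<^sup>2 / real n \<le> prob ((T ^^ (2 * n)) -` B \<inter> space N \<inter> {y \<in> space N. cmod (W \<beta> (2 * n) y) \<le> R})"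
    if \<eta>: "0 < \<eta>" for \<eta> :: real
  proof -
    \<comment> \<open>The main term is at least \<open>2 * c' * R\<^sup>2 / n\<close>. The mixing
      error and \<open>Z\<close> cost \<epsilon> each, and
      \<open>2 * \<epsilon> = c' * \<eta>\<^sup>2\<close> is at most half of it.\<close>
    define \<epsilon> where "\<epsilon> = c' * \<eta>\<^sup>2 / 2"
    have c': "0 < c'" using c B by (simp add: c'_def)
    then have \<epsilon>: "0 < \<epsilon>" using \<eta> by (simp add: \<epsilon>_def)
    obtain q where q: "\<And>n E. q \<le> n \<Longrightarrow> E \<in> sets (observed {..<n - q}) \<Longrightarrow>
        prob B * prob E - \<epsilon> \<le> prob ((T ^^ n) -` B \<inter> space N \<inter> E)"
      using uniform_mixing[OF B(1) \<epsilon>] by blast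
    have "\<exists>n0. \<forall>n\<ge>n0. \<forall>R.
        (\<integral>y. cmod (W \<beta> n y) \<partial>N) \<le> C * sqrt (real n) \<longrightarrow> \<eta> * sqrt (real n) \<le> R \<longrightarrow>
        R \<le> sqrt (real n) \<longrightarrow>
        (\<exists>E\<in>sets (observed {..<2 * n - q}). \<exists>Z\<in>sets N. c * R\<^sup>2 / real n \<le> prob E \<and> prob Z \<le> \<epsilon> \<and>
           (\<forall>y\<in>E - Z. cmod (W \<beta> (2 * n) y) \<le> R))"
      by (rule ret[THEN spec, THEN mp, OF \<eta>, THEN spec, THEN mp, OF \<epsilon>, THEN spec])
    then obtain n0 where n0: "\<forall>n\<ge>n0. \<forall>R.
        (\<integral>y. cmod (W \<beta> n y) \<partial>N) \<le> C * sqrt (real n) \<longrightarrow> \<eta> * sqrt (real n) \<le> R \<longrightarrow>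
        R \<le> sqrt (real n) \<longrightarrow>
        (\<exists>E\<in>sets (observed {..<2 * n - q}). \<exists>Z\<in>sets N. c * R\<^sup>2 / real n \<le> prob E \<and> prob Z \<le> \<epsilon> \<and>
           (\<forall>y\<in>E - Z. cmod (W \<beta> (2 * n) y) \<le> R))"
      by (elim exE) (rule that)
    show ?thesis
    proof (intro exI[of _ "n0 + q + 1"] allI impI)
      fix n R
      assume n: "n0 + q + 1 \<le> n" and good: "(\<integral>y. cmod (W \<beta> n y) \<partial>N) \<le> C * sqrt (real n)"
        and R: "\<eta> * sqrt (real n) \<le> R" "R \<le> sqrt (real n)"
      obtain E Z where E: "E \<in> sets (observed {..<2 * n - q})" and Z: "Z \<in> sets N"
        and pE: "c * R\<^sup>2 / real n \<le> prob E" and pZ: "prob Z \<le> \<epsilon>"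
        and small: "\<And>y. y \<in> E - Z \<Longrightarrow> cmod (W \<beta> (2 * n) y) \<le> R"
      proof -
        have "n0 \<le> n" using n by simp
        from n0[THEN spec, THEN mp, OF this, THEN spec, THEN mp, OF good, THEN mp, OF R(1), THEN mp, OF R(2)]
        show ?thesis using that by blast
      qed
      let ?B = "(T ^^ (2 * n)) -` B \<inter> space N"
      let ?S = "{y \<in> space N. cmod (W \<beta> (2 * n) y) \<le> R}"
      have S: "?B \<inter> ?S \<in> sets N"
        using measurable_sets[OF funpow_measurable B(1), of "2 * n"] by measurable
      have EN: "E \<in> sets N" using E observed_subset by blast
      have "(\<eta> * sqrt (real n))\<^sup>2 \<le> R\<^sup>2" using R(1) \<eta> by (intro power_mono) auto
      then have "\<eta>\<^sup>2 \<le> R\<^sup>2 / real n"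
        using n by (simp add: power_mult_distrib pos_le_divide_eq)
      then have "c' * \<eta>\<^sup>2 \<le> c' * (R\<^sup>2 / real n)" using c' by (intro mult_left_mono) auto
      then have "2 * \<epsilon> \<le> c' * R\<^sup>2 / real n" by (simp add: \<epsilon>_def)
      moreover have "2 * (c' * R\<^sup>2 / real n) \<le> prob B * prob E"
        using mult_left_mono[OF pE, of "prob B"] by (simp add: c'_def mult.assoc)
      moreover have "prob B * prob E - \<epsilon> \<le> prob (?B \<inter> E)"
        using q[OF _ E] n by simp
      moreover have "prob (?B \<inter> E) \<le> prob (?B \<inter> ?S) + prob Z"
      proof -
        have "prob (?B \<inter> E) \<le> prob ((?B \<inter> ?S) \<union> Z)"
          using small S Z by (intro finite_measure_mono) auto
        also have "\<dots> \<le> prob (?B \<inter> ?S) + prob Z" using S Z by (intro measure_Un_le) auto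
        finally show ?thesis .
      qed
      moreover have "x \<le> b" if "2 * e \<le> x" "2 * x \<le> u" "u - e \<le> a" "a \<le> b + z" "z \<le> e"
        for x u a b z e :: real
        using that by linarith
      ultimately show "c' * R\<^sup>2 / real n \<le> prob (?B \<inter> ?S)" using pZ by blast
    qed
  qed
  show ?thesis
  proof (rule exI[of _ c'], intro conjI)
    show "0 < c'" using c B by (simp add: c'_def)
  qed (rule allI, rule impI, rule main)
qed

text \<open>
  At each radius \<open>2 ^ k\<close> the expected number of visits is at most of the order \<open>4 ^ k\<close>,
  while a time \<open>2 * m\<close> with \<open>2 ^ k \<le> sqrt m\<close> contributes at least of the order \<open>4 ^ k / m\<close>.
  Weighting the radius \<open>2 ^ k\<close> by \<open>4 ^ (- k)\<close> and using \<open>J\<close> radii for each \<open>m\<close> gains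
  the arbitrarily large factor \<open>J\<close>.
\<close>

theorem recurrence:
  assumes \<beta>: "\<beta> \<in> irrational_angles" and B: "B \<in> sets N" "0 < prob B" and \<delta>: "0 < \<delta>"
    and C: "0 < C" and \<kappa>: "0 < \<kappa>"
    and dense: "\<And>N0. \<exists>n\<ge>N0. \<kappa> * harm n \<le>
      (\<Sum>m\<in>{m\<in>{1..n}. (\<integral>y. cmod (W \<beta> m y) \<partial>N) \<le> C * sqrt (real m)}. 1 / real m)"
  shows "\<exists>n\<ge>1. 0 < prob (B \<inter> ((T ^^ n) -` B \<inter> space N)
      \<inter> {y \<in> space N. cmod (W \<beta> n y) < \<delta> \<and> cmod (cis (real n * \<beta>) - 1) < \<delta>})"
proof (rule ccontr)
  assume none: "\<not> ?thesis"
  define D where "D n = B \<inter> ((T ^^ n) -` B \<inter> space N)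
      \<inter> {y \<in> space N. cmod (W \<beta> n y) < \<delta> \<and> cmod (cis (real n * \<beta>) - 1) < \<delta>}" for n
  have D: "D n \<in> sets N" for n
    using B measurable_sets[OF funpow_measurable B(1), of n] unfolding D_def by measurable
  have "\<not> 0 < prob (D n)" if "1 \<le> n" for n
    using none that unfolding D_def by blast
  then have "prob (D n) = 0" if "1 \<le> n" for n
    using that[THEN \<open>\<And>n. 1 \<le> n \<Longrightarrow> \<not> 0 < prob (D n)\<close>] measure_nonneg[of N "D n"] by linarith
  then have "D n \<in> null_sets N" if "1 \<le> n" for n
    using that D by (simp add: null_sets_def emeasure_eq_measure)
  then have null: "(\<Union>n\<in>{1..}. D n) \<in> null_sets N" by (intro null_sets_UN') auto
  \<comment> \<open>Removing countably many null sets turns the almost sure absence of close returns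
    into a statement about every point, as the packing argument works orbit by orbit.\<close>
  define B0 where "B0 = B - (\<Union>n\<in>{1..}. D n)"
  have B0: "B0 \<in> sets N" "0 < prob B0"
    using B null by (auto simp: B0_def measure_Diff_null_set)
  have sep: False if "1 \<le> n" "y \<in> B0" "(T ^^ n) y \<in> B0" "cmod (W \<beta> n y) < \<delta>"
    "cmod (cis (real n * \<beta>) - 1) < \<delta>" for n y
  proof -
    have "y \<in> space N" using that(2) sets.sets_into_space[OF B(1)] by (auto simp: B0_def)
    then have "y \<in> D n" using that by (auto simp: D_def B0_def)
    then show False using that by (auto simp: B0_def)
  qed
  have "\<exists>C>0. \<forall>R\<ge>1. \<forall>I y. finite I \<longrightarrow>
      real (card {t \<in> I. (T ^^ t) y \<in> B0 \<and> cmod (W \<beta> t y) \<le> R}) \<le> C * R\<^sup>2"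
    by (rule visits_packing[OF \<delta>]) (rule sep)
  then obtain C0 where C0: "0 < C0" and pack: "\<forall>R\<ge>1. \<forall>I y. finite I \<longrightarrow>
      real (card {t \<in> I. (T ^^ t) y \<in> B0 \<and> cmod (W \<beta> t y) \<le> R}) \<le> C0 * R\<^sup>2"
    by (elim exE conjE) (rule that)
  define p where "p t R = prob ((T ^^ t) -` B0 \<inter> space N \<inter> {y \<in> space N. cmod (W \<beta> t y) \<le> R})"
    for t R
  obtain c where c: "0 < c" and low: "\<forall>\<eta>>0. \<exists>n0. \<forall>n\<ge>n0. \<forall>R.
    (\<integral>y. cmod (W \<beta> n y) \<partial>N) \<le> C * sqrt (real n) \<longrightarrow> \<eta> * sqrt (real n) \<le> R \<longrightarrow>
    R \<le> sqrt (real n) \<longrightarrow> c * R\<^sup>2 / real n \<le> p (2 * n) R"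
    using return_probability_lower_bound[OF \<beta> C B0, folded p_def] by (elim exE conjE) (rule that)
  \<comment> \<open>The lower bound \<open>c * J * \<kappa> * harm n\<close> then exceeds the
    packing bound \<open>C0 * harm n\<close> by a full \<open>harm n\<close>, which outgrows the
    constants collected in \<open>N0\<close>.\<close>
  obtain J :: nat where J: "(C0 + 1) / (c * \<kappa>) \<le> real J" using real_arch_simple by blast
  have J': "C0 + 1 \<le> c * real J * \<kappa>"
    using J c \<kappa> by (simp add: pos_divide_le_eq mult_ac)
  obtain n0 where n0: "\<forall>n\<ge>n0. \<forall>R.
    (\<integral>y. cmod (W \<beta> n y) \<partial>N) \<le> C * sqrt (real n) \<longrightarrow> 1 / 2 ^ J * sqrt (real n) \<le> R \<longrightarrow>
    R \<le> sqrt (real n) \<longrightarrow> c * R\<^sup>2 / real n \<le> p (2 * n) R"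
    using low[THEN spec, of "1 / 2 ^ J"] by (elim impE exE) (simp, rule that)
  \<comment> \<open>From \<open>4 ^ J\<close> on, \<open>J \<le> lg m\<close>, so the truncated
    subtraction in \<open>lg m + 1 - J\<close> is exact and there really are \<open>J\<close>
    radii.\<close>
  define n1 where "n1 = n0 + 4 ^ J"
  obtain lg :: "nat \<Rightarrow> nat" where lg: "\<And>m. 1 \<le> m \<Longrightarrow> 4 ^ lg m \<le> m \<and> m < 4 ^ (lg m + 1)"
    using floor_log4_exists by blast
  have "eventually (\<lambda>n. C0 + c * real J * harm n1 < harm n) sequentially"
    using harm_at_top unfolding filterlim_at_top_dense by blast
  then obtain N0 where N0: "\<And>n. N0 \<le> n \<Longrightarrow> C0 + c * real J * harm n1 < harm n"
    unfolding eventually_sequentially by blast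
  define G where "G n = {m\<in>{1..n}. (\<integral>y. cmod (W \<beta> m y) \<partial>N) \<le> C * sqrt (real m)}" for n
  obtain n where n: "N0 + 1 \<le> n" and Gn: "\<kappa> * harm n \<le> (\<Sum>m\<in>G n. 1 / real m)"
    using dense[of "N0 + 1"] unfolding G_def by blast
  define G1 where "G1 = {m \<in> G n. n1 \<le> m}"
  have fin: "finite G1" by (simp add: G1_def G_def)
  define K where "K = lg n"
  \<comment> \<open>The number of radii is logarithmic in \<open>n\<close>, hence comparable with
    the total weight \<open>harm n\<close> of the times; \<open>ln 4 \<ge> 1\<close> makes the
    comparison constant 1.\<close>
  have K: "real K \<le> harm n"
  proof -
    have "1 \<le> ln (4::real)" using exp_le by (subst ln_ge_iff) auto
    then have "real K * 1 \<le> real K * ln 4" by (intro mult_left_mono) auto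
    also have "\<dots> = ln (4 ^ K)" by (simp add: ln_realpow)
    also have "\<dots> \<le> ln (real n + 1)"
    proof -
      have "real (4 ^ K) \<le> real n" using lg[of n] n unfolding K_def of_nat_le_iff by simp
      then have "(4::real) ^ K \<le> real n + 1" unfolding of_nat_power of_nat_numeral by linarith
      then show ?thesis by simp
    qed
    also have "\<dots> \<le> harm n" by (rule ln_le_harm)
    finally show ?thesis by simp
  qed
  have upper: "(\<Sum>m\<in>G1. p (2 * m) (2 ^ k)) \<le> C0 * 4 ^ k" for k
  proof -
    have "(\<Sum>m\<in>G1. p (2 * m) (2 ^ k)) = (\<Sum>t\<in>(*) 2 ` G1. p t (2 ^ k))"
      by (subst sum.reindex) (auto simp: inj_on_def)
    also have "\<dots> \<le> C0 * (2 ^ k)\<^sup>2"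
      unfolding p_def using fin
      by (intro sum_visit_probabilities_le B0(1) pack[rule_format]) auto
    finally show ?thesis by (simp add: power2_eq_square flip: power_mult_distrib)
  qed
  have lower: "c * real J * (1 / real m) \<le> (\<Sum>k\<le>K. p (2 * m) (2 ^ k) / 4 ^ k)" if m: "m \<in> G1" for m
  proof -
    have m1: "1 \<le> m" "m \<le> n" "n0 \<le> m" "4 ^ J \<le> m"
      and good: "(\<integral>y. cmod (W \<beta> m y) \<partial>N) \<le> C * sqrt (real m)"
      using m by (auto simp: G1_def G_def n1_def)
    have lgm: "4 ^ lg m \<le> m" "m < 4 ^ (lg m + 1)" using lg[OF m1(1)] by auto
    have "(4::nat) ^ J < 4 ^ (lg m + 1)" using m1(4) lgm(2) by linarith
    then have "J \<le> lg m" using power_less_imp_less_exp[of "4::nat" J "lg m + 1"] by simp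
    have "(4::nat) ^ lg m < 4 ^ (K + 1)"
      using lgm(1) m1(2) lg[of n] n unfolding K_def by linarith
    then have "lg m \<le> K" using power_less_imp_less_exp[of "4::nat" "lg m" "K + 1"] by simp
    \<comment> \<open>For the \<open>J\<close> largest \<open>k \<le> lg m\<close> the radius
      \<open>2 ^ k\<close> lies between \<open>sqrt m / 2 ^ J\<close> and \<open>sqrt m\<close>,
      where the return bound applies with \<open>\<eta> = 1 / 2 ^ J\<close>.\<close>
    have summand: "c / real m \<le> p (2 * m) (2 ^ k) / 4 ^ k" if k: "lg m < k + J" "k \<le> lg m" for k
    proof -
      have sq: "((2::real) ^ j)\<^sup>2 = 4 ^ j" for j
        by (simp add: power2_eq_square flip: power_mult_distrib)
      have "(4::nat) ^ k \<le> m"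
        using k(2) lgm(1) power_increasing[of k "lg m" "4::nat"] by linarith
      then have "real (4 ^ k) \<le> real m" by (simp only: of_nat_le_iff)
      then have "((2::real) ^ k)\<^sup>2 \<le> real m" unfolding sq by simp
      then have up: "2 ^ k \<le> sqrt (real m)" by (rule real_le_rsqrt)
      have "m \<le> 4 ^ (k + J)"
        using k(1) lgm(2) power_increasing[of "lg m + 1" "k + J" "4::nat"] by linarith
      then have "real m \<le> real (4 ^ (k + J))" by (simp only: of_nat_le_iff)
      then have "real m \<le> ((2::real) ^ (k + J))\<^sup>2" unfolding sq by simp
      then have "sqrt (real m) \<le> 2 ^ (k + J)" by (intro real_le_lsqrt) auto
      then have "1 / 2 ^ J * sqrt (real m) \<le> 2 ^ k"
        by (simp add: power_add pos_divide_le_eq)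
      from n0[rule_format, OF m1(3) good this up] have "c * 4 ^ k / real m \<le> p (2 * m) (2 ^ k)"
        by (simp add: sq)
      then have "c * 4 ^ k / real m / 4 ^ k \<le> p (2 * m) (2 ^ k) / 4 ^ k"
        by (rule divide_right_mono) simp
      then show ?thesis by simp
    qed
    have "c * real J * (1 / real m) = (\<Sum>k\<in>{lg m + 1 - J..lg m}. c / real m)"
      using \<open>J \<le> lg m\<close> by simp
    also have "\<dots> \<le> (\<Sum>k\<in>{lg m + 1 - J..lg m}. p (2 * m) (2 ^ k) / 4 ^ k)"
      by (intro sum_mono summand) auto
    also have "\<dots> \<le> (\<Sum>k\<le>K. p (2 * m) (2 ^ k) / 4 ^ k)"
      using \<open>lg m \<le> K\<close> by (intro sum_mono2) (auto simp: p_def)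
    finally show ?thesis .
  qed
  have "c * real J * (\<Sum>m\<in>G1. 1 / real m) \<le> (\<Sum>m\<in>G1. \<Sum>k\<le>K. p (2 * m) (2 ^ k) / 4 ^ k)"
    unfolding sum_distrib_left by (intro sum_mono lower)
  also have "\<dots> = (\<Sum>k\<le>K. (\<Sum>m\<in>G1. p (2 * m) (2 ^ k)) / 4 ^ k)"
    by (subst sum.swap) (simp add: sum_divide_distrib)
  also have "\<dots> \<le> (\<Sum>k\<le>K. C0)"
    using upper by (intro sum_mono) (simp add: pos_divide_le_eq)
  also have "\<dots> \<le> C0 * (harm n + 1)"
    using K C0 by (simp add: mult.commute)
  finally have A: "c * real J * (\<Sum>m\<in>G1. 1 / real m) \<le> C0 * (harm n + 1)" .
  have "(\<Sum>m\<in>G n. 1 / real m) \<le> (\<Sum>m\<in>G1. 1 / real m) + harm n1"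
  proof -
    have "(\<Sum>m\<in>G n. 1 / real m) \<le> (\<Sum>m\<in>G1 \<union> {1..n1}. 1 / real m)"
      using fin by (intro sum_mono2) (auto simp: G1_def G_def)
    also have "\<dots> \<le> (\<Sum>m\<in>G1. 1 / real m) + (\<Sum>m\<in>{1..n1}. 1 / real m)"
    proof -
      have "0 \<le> (\<Sum>m\<in>G1 \<inter> {1..n1}. 1 / real m)" by (intro sum_nonneg) auto
      then show ?thesis
        using sum.union_inter[of G1 "{1..n1}" "\<lambda>m. 1 / real m"] fin by simp
    qed
    also have "(\<Sum>m\<in>{1..n1}. 1 / real m) = harm n1" by (simp add: harm_def inverse_eq_divide)
    finally show ?thesis .
  qed
  then have "\<kappa> * harm n - harm n1 \<le> (\<Sum>m\<in>G1. 1 / real m)" using Gn by linarith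
  then have "c * real J * (\<kappa> * harm n - harm n1) \<le> C0 * (harm n + 1)"
    using c by (intro order_trans[OF mult_left_mono A]) auto
  moreover have "(C0 + 1) * harm n \<le> c * real J * \<kappa> * harm n"
    using J' harm_nonneg[of n] by (intro mult_right_mono) auto
  ultimately have "harm n \<le> C0 + c * real J * harm n1"
    by (simp add: algebra_simps)
  then show False using N0[of n] n by simp
qed

end

section \<open>Diffusive times of a square integrable stationary process\<close>

definition twisted_sum :: "(int \<Rightarrow> 'a \<Rightarrow> complex) \<Rightarrow> real \<Rightarrow> nat \<Rightarrow> 'a \<Rightarrow> complex" where
  "twisted_sum X \<beta> n \<omega> = (\<Sum>k<n. cis (- (real k * \<beta>)) * X (int k) \<omega>)"

definition diffusive_times :: "'a measure \<Rightarrow> (int \<Rightarrow> 'a \<Rightarrow> complex) \<Rightarrow> real \<Rightarrow> real \<Rightarrow> nat set" where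
  "diffusive_times M X \<beta> C = {m. (\<integral>\<omega>. cmod (twisted_sum X \<beta> m \<omega>) \<partial>M) \<le> C * sqrt (real m)}"

text \<open>Positive upper logarithmic density, \<open>harm n\<close> being the total weight of
  \<open>{1..n}\<close>. One pair of constants serves all \<open>N0\<close>.\<close>

definition often_diffusive :: "'a measure \<Rightarrow> (int \<Rightarrow> 'a \<Rightarrow> complex) \<Rightarrow> real \<Rightarrow> bool" where
  "often_diffusive M X \<beta> \<longleftrightarrow> (\<exists>C>0. \<exists>\<kappa>>0. \<forall>N0. \<exists>n\<ge>N0.
     \<kappa> * harm n \<le> (\<Sum>m\<in>{m\<in>{1..n}. m \<in> diffusive_times M X \<beta> C}. 1 / real m))"

lemma cis_has_integral_period:
  assumes "m \<noteq> (0::int)"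
  shows "((\<lambda>x. cis (of_int m * x)) has_integral 0) {0..2 * pi}"
proof -
  define F where "F x = cis (of_int m * x) / (\<i> * of_int m)" for x :: real
  have "((\<lambda>x. cis (of_int m * x)) has_integral (F (2 * pi) - F 0)) {0..2 * pi}"
  proof (rule fundamental_theorem_of_calculus)
    fix x :: real
    have "((\<lambda>z. exp (\<i> * of_int m * z) / (\<i> * of_int m)) has_field_derivative
        exp (\<i> * of_int m * of_real x)) (at (of_real x))"
      using assms by (auto intro!: derivative_eq_intros)
    then have "((\<lambda>x. exp (\<i> * of_int m * of_real x) / (\<i> * of_int m)) has_vector_derivative
        exp (\<i> * of_int m * of_real x)) (at x within {0..2 * pi})"
      by (rule has_vector_derivative_real_field)
    then show "(F has_vector_derivative cis (of_int m * x)) (at x within {0..2 * pi})"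
      by (simp add: F_def[abs_def] cis_conv_exp mult.assoc)
  qed simp
  moreover have "F (2 * pi) = F 0"
    using cis_multiple_2pi[of "of_int m"] by (simp add: F_def mult.commute)
  ultimately show ?thesis by simp
qed

lemma borel_measurable_cnj_compose [measurable (raw)]:
  assumes "f \<in> borel_measurable M"
  shows "(\<lambda>x. cnj (f x)) \<in> borel_measurable M"
  using measurable_compose[OF assms borel_measurable_continuous_onI[OF continuous_on_cnj[OF continuous_on_id]]]
  by simp

section \<open>Covariances and second moments of the twisted sums\<close>

locale square_integrable_process = prob_space M for M :: "'a measure" +
  fixes X :: "int \<Rightarrow> 'a \<Rightarrow> complex"
  assumes stationary: "stationary_process M borel X"
    and square_integrable: "\<And>k. integrable M (\<lambda>\<omega>. (cmod (X k \<omega>))\<^sup>2)"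
begin

lemma X_measurable [measurable]: "X k \<in> borel_measurable M"
  using stationary by (simp add: stationary_process_def)

lemma path_measurable: "(\<lambda>\<omega> k. X (k + h) \<omega>) \<in> measurable M (Pi\<^sub>M UNIV (\<lambda>_. borel))"
  by (rule measurable_PiM_single') auto

lemma path_law_shift:
  "distr M (Pi\<^sub>M UNIV (\<lambda>_. borel)) (\<lambda>\<omega> k. X (k + h) \<omega>) =
   distr M (Pi\<^sub>M UNIV (\<lambda>_. borel)) (\<lambda>\<omega> k. X k \<omega>)"
  using stationary by (simp add: stationary_process_def process_law_def)

lemma integral_shift:
  fixes F :: "(int \<Rightarrow> complex) \<Rightarrow> 'c::{banach, second_countable_topology}"
  assumes F: "F \<in> borel_measurable (Pi\<^sub>M UNIV (\<lambda>_. borel))"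
  shows "(\<integral>\<omega>. F (\<lambda>k. X (k + h) \<omega>) \<partial>M) = (\<integral>\<omega>. F (\<lambda>k. X k \<omega>) \<partial>M)"
  using integral_distr[OF path_measurable F, of h] integral_distr[OF path_measurable F, of 0]
  by (simp add: path_law_shift)

lemma covariance_shift:
  "(\<integral>\<omega>. X (j + h) \<omega> * cnj (X (k + h) \<omega>) \<partial>M) = (\<integral>\<omega>. X j \<omega> * cnj (X k \<omega>) \<partial>M)"
proof (rule integral_shift[of "\<lambda>w. w j * cnj (w k)"])
  have [measurable]: "(\<lambda>w. w i) \<in> borel_measurable (Pi\<^sub>M UNIV (\<lambda>_. borel :: complex measure))" for i :: int
    by (rule measurable_component_singleton) simp
  show "(\<lambda>w. w j * cnj (w k)) \<in> borel_measurable (Pi\<^sub>M UNIV (\<lambda>_. borel))"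
    by measurable
qed

lemma integrable_covariance: "integrable M (\<lambda>\<omega>. X j \<omega> * cnj (X k \<omega>))"
proof (rule Bochner_Integration.integrable_bound)
  show "integrable M (\<lambda>\<omega>. (cmod (X j \<omega>))\<^sup>2 + (cmod (X k \<omega>))\<^sup>2)"
    by (intro Bochner_Integration.integrable_add square_integrable)
  show "AE \<omega> in M. norm (X j \<omega> * cnj (X k \<omega>)) \<le> norm ((cmod (X j \<omega>))\<^sup>2 + (cmod (X k \<omega>))\<^sup>2)"
  proof (rule AE_I2)
    fix \<omega>
    have "a * b \<le> a\<^sup>2 + b\<^sup>2" if "0 \<le> a" "0 \<le> b" for a b :: real
    proof -
      have "0 \<le> (a - b)\<^sup>2" "0 \<le> a * b" using that by simp_all
      then show ?thesis unfolding power2_diff by linarith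
    qed
    from this[of "cmod (X j \<omega>)" "cmod (X k \<omega>)"]
    show "norm (X j \<omega> * cnj (X k \<omega>)) \<le> norm ((cmod (X j \<omega>))\<^sup>2 + (cmod (X k \<omega>))\<^sup>2)"
      by (simp add: norm_mult)
  qed
qed measurable

definition covariance :: "int \<Rightarrow> int \<Rightarrow> complex" where
  "covariance j k = (\<integral>\<omega>. X j \<omega> * cnj (X k \<omega>) \<partial>M)"

definition second_moment :: "real \<Rightarrow> nat \<Rightarrow> real" where
  "second_moment \<beta> n = (\<integral>\<omega>. (cmod (twisted_sum X \<beta> n \<omega>))\<^sup>2 \<partial>M)"

lemma twisted_sum_measurable [measurable]: "twisted_sum X \<beta> n \<in> borel_measurable M"
  unfolding twisted_sum_def[abs_def] by measurable

lemma norm_square_twisted_sum: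
  "complex_of_real ((cmod (twisted_sum X \<beta> n \<omega>))\<^sup>2) =
     (\<Sum>j<n. \<Sum>k<n. cis (of_int (int k - int j) * \<beta>) * (X (int j) \<omega> * cnj (X (int k) \<omega>)))"
proof -
  have c: "cis (of_int (int k - int j) * \<beta>) = cis (- (real j * \<beta>)) * cis (real k * \<beta>)" for j k
    by (simp add: cis_mult algebra_simps)
  show ?thesis
    unfolding complex_norm_square twisted_sum_def cnj_sum sum_product c
    by (simp add: cis_cnj mult_ac)
qed

lemma integrable_norm_square_twisted_sum:
  "integrable M (\<lambda>\<omega>. (cmod (twisted_sum X \<beta> n \<omega>))\<^sup>2)"
proof -
  have "integrable M (\<lambda>\<omega>. complex_of_real ((cmod (twisted_sum X \<beta> n \<omega>))\<^sup>2))"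
    unfolding norm_square_twisted_sum
    by (intro Bochner_Integration.integrable_sum integrable_mult_right integrable_covariance)
  then show ?thesis by (simp only: complex_of_real_integrable_eq)
qed

lemma second_moment_eq:
  "complex_of_real (second_moment \<beta> n) =
     (\<Sum>j<n. \<Sum>k<n. cis (of_int (int k - int j) * \<beta>) * covariance (int j) (int k))"
proof -
  have "complex_of_real (second_moment \<beta> n)
      = (\<integral>\<omega>. complex_of_real ((cmod (twisted_sum X \<beta> n \<omega>))\<^sup>2) \<partial>M)"
    unfolding second_moment_def by (rule integral_complex_of_real[symmetric])
  also have "\<dots> = (\<Sum>j<n. \<Sum>k<n. cis (of_int (int k - int j) * \<beta>) * covariance (int j) (int k))"
    unfolding norm_square_twisted_sum covariance_def
    by (simp add: Bochner_Integration.integral_sum Bochner_Integration.integrable_sum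
        integrable_covariance)
  finally show ?thesis .
qed

lemma second_moment_nonneg: "0 \<le> second_moment \<beta> n"
  by (simp add: second_moment_def)

lemma second_moment_continuous: "continuous_on UNIV (\<lambda>\<beta>. second_moment \<beta> n)"
proof -
  have "second_moment \<beta> n =
      Re (\<Sum>j<n. \<Sum>k<n. cis (of_int (int k - int j) * \<beta>) * covariance (int j) (int k))" for \<beta>
    by (metis Re_complex_of_real second_moment_eq)
  then show ?thesis
    by (simp only:) (intro continuous_intros)
qed

lemma diffusive_timesI:
  assumes "0 < C" "1 \<le> n" "second_moment \<beta> n \<le> C\<^sup>2 * real n"
  shows "n \<in> diffusive_times M X \<beta> C"
proof -
  define s where "s = C * sqrt (real n)"
  have s: "0 < s" using assms by (simp add: s_def)
  \<comment> \<open>The pointwise inequality of arithmetic and geometric means at scale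
    \<open>s\<close> gives integrability and replaces Cauchy-Schwarz for the means without loss: at
    second moment \<open>s\<^sup>2\<close> it returns exactly \<open>s\<close>.\<close>
  have "cmod (twisted_sum X \<beta> n \<omega>) \<le> s / 2 + (cmod (twisted_sum X \<beta> n \<omega>))\<^sup>2 / (2 * s)" for \<omega>
  proof -
    have "0 \<le> (s - cmod (twisted_sum X \<beta> n \<omega>))\<^sup>2" by simp
    then show ?thesis using s by (simp add: field_simps power2_eq_square)
  qed
  moreover have "integrable M (\<lambda>\<omega>. cmod (twisted_sum X \<beta> n \<omega>))"
  proof (rule Bochner_Integration.integrable_bound)
    show "integrable M (\<lambda>\<omega>. s / 2 + (cmod (twisted_sum X \<beta> n \<omega>))\<^sup>2 / (2 * s))"
      by (intro Bochner_Integration.integrable_add integrable_const integrable_divide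
          integrable_norm_square_twisted_sum)
  qed (use calculation s in \<open>auto intro!: AE_I2\<close>)
  ultimately have "(\<integral>\<omega>. cmod (twisted_sum X \<beta> n \<omega>) \<partial>M)
      \<le> (\<integral>\<omega>. s / 2 + (cmod (twisted_sum X \<beta> n \<omega>))\<^sup>2 / (2 * s) \<partial>M)"
    by (intro integral_mono Bochner_Integration.integrable_add integrable_const integrable_divide
          integrable_norm_square_twisted_sum)
  also have "\<dots> = s / 2 + second_moment \<beta> n / (2 * s)"
    using integrable_norm_square_twisted_sum by (simp add: second_moment_def prob_space)
  also have "\<dots> \<le> s / 2 + s\<^sup>2 / (2 * s)"
    using assms(3) s by (intro add_mono divide_right_mono) (auto simp: s_def power_mult_distrib)
  also have "\<dots> = s" using s by (simp add: power2_eq_square)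
  finally show ?thesis by (simp add: diffusive_times_def s_def)
qed

text \<open>Stationarity and conjugate symmetry: opposite lags have equal modulus, so summability
  over nonnegative lags controls the whole covariance matrix.\<close>

lemma norm_covariance_le_lag:
  "cmod (covariance (int j) (int k)) =
     cmod (covariance (int (if k \<le> j then j - k else k - j)) 0)"
proof (cases "k \<le> j")
  case True
  then show ?thesis
    using covariance_shift[of "int (j - k)" "int k" 0] by (simp add: covariance_def)
next
  case False
  then have "covariance (int j) (int k) = covariance 0 (int (k - j))"
    using covariance_shift[of 0 "int j" "int (k - j)"] by (simp add: covariance_def)
  also have "\<dots> = cnj (covariance (int (k - j)) 0)"
    using Bochner_Integration.integral_cnj[of M "\<lambda>\<omega>. X (int (k - j)) \<omega> * cnj (X 0 \<omega>)"]
    by (simp add: covariance_def mult.commute)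
  finally show ?thesis using False by simp
qed

lemma often_diffusive_if_summable:
  assumes sm: "summable (\<lambda>k::nat. cmod (covariance (int k) 0))"
  shows "often_diffusive M X \<beta>"
proof -
  define \<rho> where "\<rho> k = cmod (covariance (int k) 0)" for k :: nat
  define S where "S = (\<Sum>k. \<rho> k)"
  have part: "(\<Sum>k\<in>A. \<rho> k) \<le> S" if "finite A" for A
    unfolding S_def using sm that by (intro sum_le_suminf) (auto simp: \<rho>_def)
  have S: "0 \<le> S" using part[of "{}"] by simp
  \<comment> \<open>The summand 1 keeps \<open>C\<close> positive when all covariances
    vanish.\<close>
  define C where "C = sqrt (2 * S + 1)"
  have C: "0 < C" "C\<^sup>2 = 2 * S + 1" using S by (simp_all add: C_def)
  have "m \<in> diffusive_times M X \<beta> C" if "1 \<le> m" for m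
  proof (rule diffusive_timesI[OF C(1) that])
    \<comment> \<open>Each lag occurs at most once on either side of the diagonal.\<close>
    have row: "(\<Sum>k<m. cmod (covariance (int j) (int k))) \<le> 2 * S" for j
    proof -
      have "(\<Sum>k<m. cmod (covariance (int j) (int k)))
          = (\<Sum>k<m. \<rho> (if k \<le> j then j - k else k - j))"
        by (intro sum.cong refl) (simp only: norm_covariance_le_lag \<rho>_def)
      also have "\<dots> = (\<Sum>k\<in>{k. k < m \<and> k \<le> j}. \<rho> (j - k)) + (\<Sum>k\<in>{k. k < m \<and> \<not> k \<le> j}. \<rho> (k - j))"
        by (simp add: if_distrib sum.If_cases Int_def Compl_eq)
      also have "(\<Sum>k\<in>{k. k < m \<and> k \<le> j}. \<rho> (j - k)) = (\<Sum>i\<in>(\<lambda>k. j - k) ` {k. k < m \<and> k \<le> j}. \<rho> i)"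
        by (subst sum.reindex) (auto simp: inj_on_def)
      also have "\<dots> \<le> S" by (intro part) auto
      also have "(\<Sum>k\<in>{k. k < m \<and> \<not> k \<le> j}. \<rho> (k - j))
          = (\<Sum>i\<in>(\<lambda>k. k - j) ` {k. k < m \<and> \<not> k \<le> j}. \<rho> i)"
        by (subst sum.reindex) (auto simp: inj_on_def)
      also have "\<dots> \<le> S" by (intro part) auto
      finally show ?thesis by simp
    qed
    have "second_moment \<beta> m = cmod (complex_of_real (second_moment \<beta> m))"
      using second_moment_nonneg by simp
    also have "\<dots> \<le> (\<Sum>j<m. \<Sum>k<m. cmod (covariance (int j) (int k)))"
      unfolding second_moment_eq
      by (intro order_trans[OF norm_sum] sum_mono) (simp add: norm_mult)
    also have "\<dots> \<le> (\<Sum>j<m. 2 * S)" by (intro sum_mono row)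
    also have "\<dots> \<le> C\<^sup>2 * real m" by (simp add: C(2) algebra_simps)
    finally show "second_moment \<beta> m \<le> C\<^sup>2 * real m" .
  qed
  then have "{m\<in>{1..n}. m \<in> diffusive_times M X \<beta> C} = {1..n}" for n by auto
  then have "1 * harm n \<le> (\<Sum>m\<in>{m\<in>{1..n}. m \<in> diffusive_times M X \<beta> C}. 1 / real m)" for n
    by (simp add: harm_def inverse_eq_divide)
  then show ?thesis
    unfolding often_diffusive_def using C(1) by (meson order_refl zero_less_one)
qed

text \<open>Orthogonality of the characters leaves only the \<open>n\<close> diagonal
  covariances.\<close>

lemma second_moment_has_integral:
  "((\<lambda>\<beta>. second_moment \<beta> n) has_integral (2 * pi * Re (covariance 0 0) * real n)) {0..2 * pi}"
proof -
  have entry: "((\<lambda>\<beta>. cis (of_int (int k - int j) * \<beta>) * covariance (int j) (int k)) has_integral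
      (if k = j then complex_of_real (2 * pi) * covariance 0 0 else 0)) {0..2 * pi}" for j k
  proof (cases "k = j")
    case True
    have "covariance (int j) (int j) = covariance 0 0"
      using covariance_shift[of 0 "int j" 0] by (simp add: covariance_def)
    then show ?thesis
      using True has_integral_const_real[of "covariance 0 0" 0 "2 * pi"]
      by (simp add: scaleR_conv_of_real)
  next
    case False
    then have "int k - int j \<noteq> 0" by simp
    from has_integral_mult_left[OF cis_has_integral_period[OF this], of "covariance (int j) (int k)"]
    show ?thesis using False by simp
  qed
  have "((\<lambda>\<beta>. complex_of_real (second_moment \<beta> n)) has_integral
      (\<Sum>j<n. \<Sum>k<n. if k = j then complex_of_real (2 * pi) * covariance 0 0 else 0)) {0..2 * pi}"
    unfolding second_moment_eq by (intro has_integral_sum entry) auto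
  from has_integral_linear[OF this bounded_linear_Re]
  show ?thesis by (simp add: o_def mult_ac)
qed

text \<open>
  The mean of \<open>second_moment \<beta> m / m\<close> over the angle \<open>\<beta>\<close> does not depend on \<open>m\<close>, so by
  Fatou's lemma the logarithmic means over \<open>m\<close> have a finite lower limit for almost every
  angle; a Markov bound then produces the diffusive times.
\<close>

lemma AE_often_diffusive: "AE \<beta> in lborel. \<beta> \<in> {0..2 * pi} \<longrightarrow> often_diffusive M X \<beta>"
proof -
  define r where "r = 2 * pi * Re (covariance 0 0)"
  \<comment> \<open>Logarithmic mean of \<open>second_moment \<beta> m / m\<close>; the weight
    \<open>1 / m\<close> accounts for the square.\<close>
  define L where "L K \<beta> = (\<Sum>m\<in>{1..K}. second_moment \<beta> m / (real m)\<^sup>2) / harm K" for K \<beta>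
  \<comment> \<open>\<open>Suc K\<close> avoids the division by \<open>harm 0 = 0\<close>, which
    would break the constancy of the integrals.\<close>
  define G where "G K \<beta> = ennreal (L (Suc K) \<beta>) * indicator {0..2 * pi} \<beta>" for K \<beta>
  have L_nonneg: "0 \<le> L K \<beta>" for K \<beta>
    by (simp add: L_def second_moment_nonneg sum_nonneg harm_nonneg)
  have L_int: "((\<lambda>\<beta>. L (Suc K) \<beta>) has_integral r) {0..2 * pi}" for K
  proof -
    have "((\<lambda>\<beta>. L (Suc K) \<beta>) has_integral (\<Sum>m\<in>{1..Suc K}. r * real m / (real m)\<^sup>2) / harm (Suc K))
        {0..2 * pi}"
      unfolding L_def r_def
      by (intro has_integral_divide has_integral_sum second_moment_has_integral) auto
    also have "(\<Sum>m\<in>{1..Suc K}. r * real m / (real m)\<^sup>2) = r * harm (Suc K)"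
      unfolding harm_def sum_distrib_left
      by (intro sum.cong refl) (simp add: power2_eq_square inverse_eq_divide)
    also have "r * harm (Suc K) / harm (Suc K) = r"
      using less_imp_neq[OF harm_pos[OF zero_less_Suc[of K], where 'a = real]] by (intro nonzero_mult_div_cancel_right) metis
    finally show ?thesis .
  qed
  have [measurable]: "(\<lambda>\<beta>. second_moment \<beta> m) \<in> borel_measurable borel" for m
    by (rule borel_measurable_continuous_onI[OF second_moment_continuous])
  have [measurable]: "G K \<in> borel_measurable borel" for K
    unfolding G_def L_def by measurable
  have "(\<integral>\<^sup>+\<beta>. liminf (\<lambda>K. G K \<beta>) \<partial>lborel) \<le> liminf (\<lambda>K. \<integral>\<^sup>+\<beta>. G K \<beta> \<partial>lborel)"
    by (rule nn_integral_liminf) measurable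
  also have "(\<lambda>K. \<integral>\<^sup>+\<beta>. G K \<beta> \<partial>lborel) = (\<lambda>K. ennreal r)"
    unfolding G_def using L_nonneg L_int by (intro ext nn_integral_has_integral_lebesgue') auto
  also have "liminf (\<lambda>K. ennreal r) = ennreal r" by (simp add: Liminf_const)
  finally have "(\<integral>\<^sup>+\<beta>. liminf (\<lambda>K. G K \<beta>) \<partial>lborel) \<noteq> \<infinity>"
    by (auto simp: top_unique)
  then have "AE \<beta> in lborel. liminf (\<lambda>K. G K \<beta>) \<noteq> \<infinity>"
    by (intro nn_integral_PInf_AE) measurable
  then show ?thesis
  proof eventually_elim
    case (elim \<beta>)
    show ?case
    proof
      assume \<beta>: "\<beta> \<in> {0..2 * pi}"
      obtain l where l: "0 \<le> l" "liminf (\<lambda>K. G K \<beta>) = ennreal l"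
        using elim by (cases "liminf (\<lambda>K. G K \<beta>)") auto
      have freq: "\<exists>n\<ge>N0. 1 \<le> n \<and> L n \<beta> \<le> l + 1" for N0
      proof (rule ccontr)
        assume contra: "\<not> ?thesis"
        have "eventually (\<lambda>K. ennreal (l + 1) \<le> G K \<beta>) sequentially"
          unfolding eventually_sequentially
        proof (intro exI[of _ N0] allI impI)
          fix K assume "N0 \<le> K"
          then have "l + 1 \<le> L (Suc K) \<beta>" using contra by (auto simp: not_le dest: spec[of _ "Suc K"])
          then show "ennreal (l + 1) \<le> G K \<beta>" using \<beta> by (simp add: G_def ennreal_leI)
        qed
        then have "ennreal (l + 1) \<le> ennreal l" unfolding l(2)[symmetric] by (rule Liminf_bounded)
        then show False using l(1) by (simp add: ennreal_le_iff)
      qed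
      \<comment> \<open>Markov's inequality bounds the logarithmic weight of the remaining times by
        \<open>(l + 1) * harm n / C\<^sup>2\<close>, which is now half of the total.\<close>
      define C where "C = sqrt (2 * (l + 1))"
      have C: "0 < C" "C\<^sup>2 = 2 * (l + 1)" using l(1) by (simp_all add: C_def)
      have dense: "1 / 2 * harm n \<le> (\<Sum>m\<in>{m\<in>{1..n}. m \<in> diffusive_times M X \<beta> C}. 1 / real m)"
        if n: "1 \<le> n" "L n \<beta> \<le> l + 1" for n
      proof -
        have h: "0 < (harm n :: real)" using n by (intro harm_pos) simp
        define Bad where "Bad = {m\<in>{1..n}. m \<notin> diffusive_times M X \<beta> C}"
        have "(\<Sum>m\<in>Bad. 1 / real m) \<le> (\<Sum>m\<in>Bad. second_moment \<beta> m / (real m)\<^sup>2 / C\<^sup>2)"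
        proof (rule sum_mono)
          fix m assume m: "m \<in> Bad"
          then have "C\<^sup>2 * real m < second_moment \<beta> m"
            using diffusive_timesI[OF C(1), of m \<beta>] by (cases "second_moment \<beta> m \<le> C\<^sup>2 * real m") (auto simp: Bad_def)
          then have "C\<^sup>2 * real m / (C\<^sup>2 * (real m)\<^sup>2) \<le> second_moment \<beta> m / (C\<^sup>2 * (real m)\<^sup>2)"
            using C(1) by (intro divide_right_mono) auto
          moreover have "C\<^sup>2 * real m / (C\<^sup>2 * (real m)\<^sup>2) = 1 / real m"
            using C(1) m by (simp add: power2_eq_square Bad_def)
          ultimately show "1 / real m \<le> second_moment \<beta> m / (real m)\<^sup>2 / C\<^sup>2"
            by (simp add: mult.commute)
        qed
        also have "\<dots> \<le> (\<Sum>m\<in>{1..n}. second_moment \<beta> m / (real m)\<^sup>2 / C\<^sup>2)"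
          by (intro sum_mono2) (auto simp: Bad_def second_moment_nonneg)
        also have "\<dots> = L n \<beta> * harm n / C\<^sup>2"
        proof -
          have "L n \<beta> * harm n = (\<Sum>m\<in>{1..n}. second_moment \<beta> m / (real m)\<^sup>2)"
            using less_imp_neq[OF h] unfolding L_def by (metis nonzero_divide_eq_eq)
          then show ?thesis by (simp only: sum_divide_distrib)
        qed
        also have "\<dots> \<le> (l + 1) * harm n / C\<^sup>2"
          using n(2) by (intro divide_right_mono mult_right_mono harm_nonneg) auto
        also have "\<dots> = harm n / 2" using l(1) unfolding C(2) by (simp add: field_simps)
        finally have bad: "(\<Sum>m\<in>Bad. 1 / real m) \<le> harm n / 2" .
        have "harm n = (\<Sum>m\<in>{1..n}. 1 / real m)" by (simp add: harm_def inverse_eq_divide)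
        also have "\<dots> = (\<Sum>m\<in>{m\<in>{1..n}. m \<in> diffusive_times M X \<beta> C}. 1 / real m) + (\<Sum>m\<in>Bad. 1 / real m)"
          unfolding Bad_def by (subst sum.union_disjoint[symmetric]) (auto intro: sum.cong)
        finally show ?thesis using bad by linarith
      qed
      show "often_diffusive M X \<beta>"
        unfolding often_diffusive_def
      proof (rule exI[of _ C], intro conjI C(1), rule exI[of _ "1 / 2"], intro conjI allI)
        fix N0
        obtain n where "N0 \<le> n" "1 \<le> n" "L n \<beta> \<le> l + 1" using freq by blast
        then show "\<exists>n\<ge>N0. 1 / 2 * harm n
            \<le> (\<Sum>m\<in>{m\<in>{1..n}. m \<in> diffusive_times M X \<beta> C}. 1 / real m)"
          using dense by blast
      qed simp
    qed
  qed
qed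

end

section \<open>Transfer to realizations\<close>

text \<open>Events of the process and of its realization are both preimages of these, so that their
  probabilities can be compared through the common path law.\<close>

definition path_events :: "int set \<Rightarrow> (int \<Rightarrow> complex) set set" where
  "path_events K = sigma_sets UNIV {(\<lambda>w. w k) -` C | k C. k \<in> K \<and> C \<in> sets borel}"

lemma space_complex_paths: "space (Pi\<^sub>M (UNIV :: int set) (\<lambda>_. borel :: complex measure)) = UNIV"
  by (simp add: space_PiM)

lemma coordinate_measurable [measurable]:
  "(\<lambda>w. w k) \<in> borel_measurable (Pi\<^sub>M (UNIV :: int set) (\<lambda>_. borel :: complex measure))"
  by (rule measurable_component_singleton) simp

lemma path_events_subset: "path_events K \<subseteq> sets (Pi\<^sub>M UNIV (\<lambda>_. borel))"
  unfolding path_events_def space_complex_paths[symmetric]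
  by (rule sets.sigma_sets_subset)
    (use measurable_sets[OF coordinate_measurable] in \<open>auto simp: space_complex_paths\<close>)

text \<open>Both inclusions are used: preimages of path events are generated by the process, and
  every observed event of a realization is such a preimage.\<close>

lemma path_events_vimage:
  "{(\<lambda>\<omega> k. Y k \<omega>) -` A \<inter> \<Omega> | A. A \<in> path_events K} =
   sigma_sets \<Omega> {Y k -` C \<inter> \<Omega> | k C. k \<in> K \<and> C \<in> sets borel}"
proof -
  let ?G = "{(\<lambda>w. w k) -` C | k C. k \<in> K \<and> C \<in> sets borel} :: (int \<Rightarrow> complex) set set"
  have eq: "(\<lambda>\<omega> k. Y k \<omega>) -` ((\<lambda>w. w k) -` C) \<inter> \<Omega> = Y k -` C \<inter> \<Omega>" for k C by auto
  have "{(\<lambda>\<omega> k. Y k \<omega>) -` A \<inter> \<Omega> | A. A \<in> path_events K}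
      = sigma_sets \<Omega> {(\<lambda>\<omega> k. Y k \<omega>) -` A \<inter> \<Omega> | A. A \<in> ?G}"
    unfolding path_events_def by (rule sigma_sets_vimage_commute) simp
  also have "{(\<lambda>\<omega> k. Y k \<omega>) -` A \<inter> \<Omega> | A. A \<in> ?G} = {Y k -` C \<inter> \<Omega> | k C. k \<in> K \<and> C \<in> sets borel}"
  proof (intro equalityI subsetI)
    fix D assume "D \<in> {(\<lambda>\<omega> k. Y k \<omega>) -` A \<inter> \<Omega> | A. A \<in> ?G}"
    then obtain k C where "D = (\<lambda>\<omega> k. Y k \<omega>) -` ((\<lambda>w. w k) -` C) \<inter> \<Omega>" "k \<in> K" "C \<in> sets borel"
      by blast
    then show "D \<in> {Y k -` C \<inter> \<Omega> | k C. k \<in> K \<and> C \<in> sets borel}" unfolding eq by blast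
  next
    fix D assume "D \<in> {Y k -` C \<inter> \<Omega> | k C. k \<in> K \<and> C \<in> sets borel}"
    then obtain k C where "D = Y k -` C \<inter> \<Omega>" "k \<in> K" "C \<in> sets borel" by blast
    then have "D = (\<lambda>\<omega> k. Y k \<omega>) -` ((\<lambda>w. w k) -` C) \<inter> \<Omega>" "(\<lambda>w. w k) -` C \<in> ?G"
      unfolding eq by blast+
    then show "D \<in> {(\<lambda>\<omega> k. Y k \<omega>) -` A \<inter> \<Omega> | A. A \<in> ?G}" by blast
  qed
  finally show ?thesis .
qed

lemma (in prob_space) alpha_coeff_upper:
  assumes "A \<in> generated_events M X {..0}" "B \<in> generated_events M X {n<..}"
  shows "\<bar>prob (A \<inter> B) - prob A * prob B\<bar> \<le> alpha_coeff M X n"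
proof -
  \<comment> \<open>A real supremum dominates its terms only when the family is bounded.\<close>
  have bd: "\<bar>prob (A \<inter> B) - prob A * prob B\<bar> \<le> 1" for A B
  proof -
    have "0 \<le> prob A * prob B" by (intro mult_nonneg_nonneg measure_nonneg)
    moreover have "prob A * prob B \<le> 1" by (intro mult_le_one prob_le_1 measure_nonneg)
    moreover have "0 \<le> prob (A \<inter> B)" "prob (A \<inter> B) \<le> 1" by auto
    ultimately show ?thesis unfolding abs_le_iff by linarith
  qed
  show ?thesis
    unfolding alpha_coeff_def
  proof (rule cSUP_upper2[where x = "(A, B)"])
    show "bdd_above ((\<lambda>(A, B). \<bar>prob (A \<inter> B) - prob A * prob B\<bar>) `
        (generated_events M X {..0} \<times> generated_events M X {n<..}))"
      using bd by (intro bdd_aboveI[of _ 1]) auto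
  qed (use assms in auto)
qed

context square_integrable_process
begin

lemma path_events_generated:
  assumes "A \<in> path_events K"
  shows "(\<lambda>\<omega> k. X (k + h) \<omega>) -` A \<inter> space M \<in> generated_events M X ((\<lambda>k. k + h) ` K)"
proof -
  have "(\<lambda>\<omega> k. X (k + h) \<omega>) -` A \<inter> space M \<in> sigma_sets (space M)
      {X (k + h) -` C \<inter> space M | k C. k \<in> K \<and> C \<in> sets borel}"
    using path_events_vimage[of "\<lambda>k. X (k + h)" "space M" K] assms by blast
  also have "\<dots> \<subseteq> generated_events M X ((\<lambda>k. k + h) ` K)"
    unfolding generated_events_def by (rule sigma_sets_mono') blast
  finally show ?thesis .
qed

lemma generated_events_mono: "K \<subseteq> L \<Longrightarrow> generated_events M X K \<subseteq> generated_events M X L"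
  unfolding generated_events_def by (rule sigma_sets_mono') blast

lemma path_events_mixing:
  assumes A: "A \<in> path_events {..<a}" and B: "B \<in> path_events {a + int g..}"
  shows "\<bar>prob ((\<lambda>\<omega> k. X k \<omega>) -` (A \<inter> B) \<inter> space M)
     - prob ((\<lambda>\<omega> k. X k \<omega>) -` A \<inter> space M) * prob ((\<lambda>\<omega> k. X k \<omega>) -` B \<inter> space M)\<bar>
     \<le> alpha_coeff M X (int g)"
proof -
  \<comment> \<open>This shift moves the last past index \<open>a - 1\<close> to 0 and the first
    future index \<open>a + g\<close> to \<open>g + 1\<close>, the least element of
    \<open>{g<..}\<close>.\<close>
  define h where "h = 1 - a"
  let ?S = "\<lambda>\<omega> k. X (k + h) \<omega>"
  have shift: "prob ((\<lambda>\<omega> k. X k \<omega>) -` D \<inter> space M) = prob (?S -` D \<inter> space M)"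
    if "D \<in> sets (Pi\<^sub>M UNIV (\<lambda>_. borel))" for D
    using measure_distr[OF path_measurable that, of h] measure_distr[OF path_measurable that, of 0]
    by (simp add: path_law_shift)
  have AB: "A \<in> sets (Pi\<^sub>M UNIV (\<lambda>_. borel))" "B \<in> sets (Pi\<^sub>M UNIV (\<lambda>_. borel))"
    using A B path_events_subset by blast+
  have "?S -` A \<inter> space M \<in> generated_events M X {..0}"
    using path_events_generated[OF A, of h] by (rule generated_events_mono[THEN subsetD, rotated])
      (auto simp: h_def)
  moreover have "?S -` B \<inter> space M \<in> generated_events M X {int g<..}"
    using path_events_generated[OF B, of h] by (rule generated_events_mono[THEN subsetD, rotated])
      (auto simp: h_def)
  ultimately have "\<bar>prob ((?S -` A \<inter> space M) \<inter> (?S -` B \<inter> space M))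
      - prob (?S -` A \<inter> space M) * prob (?S -` B \<inter> space M)\<bar> \<le> alpha_coeff M X (int g)"
    by (rule alpha_coeff_upper)
  moreover have "(?S -` A \<inter> space M) \<inter> (?S -` B \<inter> space M) = ?S -` (A \<inter> B) \<inter> space M" by auto
  ultimately show ?thesis using AB by (simp only: shift sets.Int)
qed

lemma X_integrable: "integrable M (X k)"
proof (rule Bochner_Integration.integrable_bound)
  show "integrable M (\<lambda>\<omega>. 1 + (cmod (X k \<omega>))\<^sup>2)"
    by (intro Bochner_Integration.integrable_add integrable_const square_integrable)
  have "a \<le> 1 + a\<^sup>2" for a :: real
    using zero_le_power2[of "a - 1 / 2"] by (simp add: power2_eq_square algebra_simps)
  then show "AE \<omega> in M. norm (X k \<omega>) \<le> norm (1 + (cmod (X k \<omega>))\<^sup>2)" by (intro AE_I2) simp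
qed measurable

lemma increments_measurable:
  assumes "cmod u = 1"
  shows "(\<lambda>\<omega>. (X k \<omega>, u)) \<in> measurable M motion_borel"
  unfolding motion_borel_def
  by (rule measurable_restrict_space2) (use assms in \<open>auto simp: motion_group_def\<close>)

lemma increments_stationary:
  assumes u: "cmod u = 1"
  shows "stationary_process M motion_borel (\<lambda>k \<omega>. (X k \<omega>, u))"
  unfolding stationary_process_def
proof (intro conjI allI)
  fix h :: int
  let ?P = "Pi\<^sub>M UNIV (\<lambda>_. borel) :: (int \<Rightarrow> complex) measure"
  let ?Q = "Pi\<^sub>M UNIV (\<lambda>_. motion_borel) :: (int \<Rightarrow> complex \<times> complex) measure"
  have pair: "(\<lambda>w k. (w k, u)) \<in> measurable ?P ?Q"
  proof (rule measurable_PiM_single')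
    show "(\<lambda>w. (w k, u)) \<in> measurable ?P motion_borel" for k
      unfolding motion_borel_def
      by (rule measurable_restrict_space2) (use u in \<open>auto simp: motion_group_def\<close>)
  qed (use u in \<open>auto simp: space_motion_borel motion_group_def\<close>)
  have "process_law M motion_borel (\<lambda>k \<omega>. (X (k + j) \<omega>, u))
      = distr (distr M ?P (\<lambda>\<omega> k. X (k + j) \<omega>)) ?Q (\<lambda>w k. (w k, u))" for j
    unfolding process_law_def using distr_distr[OF pair path_measurable] by (simp add: comp_def)
  from this[of h] this[of 0]
  show "process_law M motion_borel (\<lambda>k \<omega>. (X (k + h) \<omega>, u)) =
      process_law M motion_borel (\<lambda>k \<omega>. (X k \<omega>, u))"
    by (simp add: path_law_shift)
qed (rule increments_measurable[OF u])

end

section \<open>Recurrence of the cocycle over an arbitrary realization\<close>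

lemma borel_measurable_motion_borelD:
  assumes "f \<in> measurable N motion_borel"
  shows "f \<in> borel_measurable N" "\<And>y. y \<in> space N \<Longrightarrow> f y \<in> carrier motion_group"
  using assms unfolding motion_borel_def measurable_restrict_space2_iff by auto

lemma borel_measurable_fst_compose [measurable (raw)]:
  assumes "f \<in> borel_measurable N"
  shows "(\<lambda>x. fst (f x)) \<in> borel_measurable N"
  using measurable_compose[OF assms borel_measurable_continuous_onI[OF continuous_on_fst[OF continuous_on_id]]] .

lemma borel_measurable_snd_compose [measurable (raw)]:
  assumes "f \<in> borel_measurable N"
  shows "(\<lambda>x. snd (f x)) \<in> borel_measurable N"
  using measurable_compose[OF assms borel_measurable_continuous_onI[OF continuous_on_snd[OF continuous_on_id]]] .

lemma left_product_measurable:
  assumes "\<And>k. g k \<in> borel_measurable N"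
  shows "(\<lambda>y. left_product (\<lambda>k. g k y) n) \<in> borel_measurable N"
proof (induction n)
  case (Suc n)
  have [measurable]: "g n \<in> borel_measurable N" "(\<lambda>y. left_product (\<lambda>k. g k y) n) \<in> borel_measurable N"
    by (fact assms Suc)+
  have "(\<lambda>y. left_product (\<lambda>k. g k y) (Suc n))
      = (\<lambda>y. (fst (g n y) + snd (g n y) * fst (left_product (\<lambda>k. g k y) n),
             snd (g n y) * snd (left_product (\<lambda>k. g k y) n)))"
    by (simp add: motion_group_def case_prod_beta)
  also have "\<dots> \<in> borel_measurable N" by measurable
  finally show ?case .
qed simp

lemma motion_group_nhd_one:
  assumes "openin (top_of_set (carrier motion_group)) U" "\<one>\<^bsub>motion_group\<^esub> \<in> U"
  shows "U \<in> sets borel" and "\<exists>\<delta>>0. \<forall>z u. cmod u = 1 \<longrightarrow> cmod z < \<delta> \<longrightarrow> cmod (u - 1) < \<delta> \<longrightarrow> (z, u) \<in> U"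
proof -
  obtain V where V: "open V" "U = carrier motion_group \<inter> V"
    using assms(1) unfolding openin_open by blast
  have "closed (carrier motion_group)" by (simp add: motion_group_def closed_Times)
  then show "U \<in> sets borel" using V by auto
  have "(0, 1) \<in> V" using assms(2) V by (simp add: motion_group_def)
  then obtain e where e: "0 < e" "\<And>q. dist q (0, 1) < e \<Longrightarrow> q \<in> V"
    using V(1) unfolding open_dist by blast
  have "(z, u) \<in> U" if "cmod u = 1" "cmod z < e / 2" "cmod (u - 1) < e / 2" for z u
  proof -
    have "dist (z, u) (0, 1) \<le> cmod z + cmod (u - 1)"
    proof -
      have "dist (z, u) (0, 1) = sqrt ((cmod z)\<^sup>2 + (cmod (u - 1))\<^sup>2)"
        by (simp only: dist_Pair_Pair) (simp add: dist_norm)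
      also have "\<dots> \<le> cmod z + cmod (u - 1)" by (rule sqrt_sum_squares_le_sum) auto
      finally show ?thesis .
    qed
    then have "(z, u) \<in> V" using that by (intro e(2)) linarith
    then show ?thesis using that(1) by (simp add: V(2) motion_group_def)
  qed
  then show "\<exists>\<delta>>0. \<forall>z u. cmod u = 1 \<longrightarrow> cmod z < \<delta> \<longrightarrow> cmod (u - 1) < \<delta> \<longrightarrow> (z, u) \<in> U"
    using e(1) by (intro exI[of _ "e / 2"]) auto
qed

lemma int_iterate_measurable:
  fixes N :: "'b measure"
  assumes T: "T \<in> measurable N N" and T': "the_inv_into (space N) T \<in> measurable N N"
  shows "int_iterate N T k \<in> measurable N N"
  unfolding int_iterate_def using T T' by (auto intro: measurable_funpow)

context square_integrable_process
begin

theorem recurrent_realization: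
  fixes N :: "'b measure"
  assumes mix: "alpha_mixing M X" and \<beta>: "\<beta> \<in> irrational_angles" and diff: "often_diffusive M X \<beta>"
    and real: "realization M (\<lambda>k \<omega>. (X k \<omega>, cis \<beta>)) N T f"
  shows "recurrent_cocycle N T f"
proof -
  let ?P = "Pi\<^sub>M UNIV (\<lambda>_. borel) :: (int \<Rightarrow> complex) measure"
  let ?Q = "Pi\<^sub>M UNIV (\<lambda>_. motion_borel) :: (int \<Rightarrow> complex \<times> complex) measure"
  have "prob_space N" and T: "T \<in> measurable N N" and T': "the_inv_into (space N) T \<in> measurable N N"
    and inv: "distr N N T = N" and f: "f \<in> measurable N motion_borel"
    and law: "process_law N motion_borel (\<lambda>k y. f (int_iterate N T k y))
      = process_law M motion_borel (\<lambda>k \<omega>. (X k \<omega>, cis \<beta>))"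
    using real by (auto simp: realization_def standard_prob_space_def pp_automorphism_def)
  then interpret N: prob_space N by simp
  note iter = int_iterate_measurable[OF T T']
  have iter_nat: "int_iterate N T (int k) = T ^^ k" for k by (simp add: int_iterate_def)
  define v where "v y = fst (f y)" for y
  have fb [measurable]: "f \<in> borel_measurable N" by (rule borel_measurable_motion_borelD(1)[OF f])
  define \<phi> where "\<phi> y = (\<lambda>k. f (int_iterate N T k y))" for y
  define \<psi> where "\<psi> \<omega> = (\<lambda>k. (X k \<omega>, cis \<beta>))" for \<omega> and k :: int
  have "f (int_iterate N T k y) \<in> carrier motion_group" if "y \<in> space N" for k y
    using measurable_space[OF iter that] borel_measurable_motion_borelD(2)[OF f] by blast
  then have \<phi>: "\<phi> \<in> measurable N ?Q"
    unfolding \<phi>_def using measurable_compose[OF iter f]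
    by (intro measurable_PiM_single') (auto simp: space_motion_borel)
  have \<psi>: "\<psi> \<in> measurable M ?Q"
    unfolding \<psi>_def using increments_measurable[of "cis \<beta>"]
    by (intro measurable_PiM_single') (auto simp: space_motion_borel motion_group_def)
  have law': "distr N ?Q \<phi> = distr M ?Q \<psi>"
    using law unfolding process_law_def \<phi>_def \<psi>_def .
  \<comment> \<open>Only the law of the realization is prescribed, so the rotation part of
    \<open>f\<close> equals \<open>cis \<beta>\<close> merely almost everywhere; countability of the
    times allows one exceptional set for all of them.\<close>
  have AE_snd: "AE y in N. \<forall>k. snd (f (int_iterate N T k y)) = cis \<beta>"
  proof -
    have [measurable]: "(\<lambda>w. w k) \<in> borel_measurable ?Q" for k
      by (rule borel_measurable_motion_borelD(1), rule measurable_component_singleton) simp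
    have sets: "{w \<in> space ?Q. \<forall>k. snd (w k) = cis \<beta>} \<in> sets ?Q" by measurable
    have "AE w in distr N ?Q \<phi>. \<forall>k. snd (w k) = cis \<beta>"
      unfolding law' AE_distr_iff[OF \<psi> sets] by (simp add: \<psi>_def)
    then show ?thesis unfolding AE_distr_iff[OF \<phi> sets] by (simp add: \<phi>_def)
  qed
  have law_fst: "distr N ?P (\<lambda>y k. v (int_iterate N T k y)) = distr M ?P (\<lambda>\<omega> k. X k \<omega>)"
    and path_N: "(\<lambda>y k. v (int_iterate N T k y)) \<in> measurable N ?P"
  proof -
    have "(\<lambda>w. w k) \<in> borel_measurable ?Q" for k
      by (rule borel_measurable_motion_borelD(1), rule measurable_component_singleton) simp
    then have fst_meas: "(\<lambda>w k. fst (w k)) \<in> measurable ?Q ?P"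
      by (intro measurable_PiM_single') (auto intro: borel_measurable_fst_compose)
    have "distr (distr N ?Q \<phi>) ?P (\<lambda>w k. fst (w k)) = distr (distr M ?Q \<psi>) ?P (\<lambda>w k. fst (w k))"
      by (simp only: law')
    then show "distr N ?P (\<lambda>y k. v (int_iterate N T k y)) = distr M ?P (\<lambda>\<omega> k. X k \<omega>)"
      unfolding distr_distr[OF fst_meas \<phi>] distr_distr[OF fst_meas \<psi>]
      by (simp add: comp_def \<phi>_def \<psi>_def v_def)
    show "(\<lambda>y k. v (int_iterate N T k y)) \<in> measurable N ?P"
      using measurable_comp[OF \<phi> fst_meas] by (simp add: comp_def \<phi>_def v_def)
  qed
  have path_M: "(\<lambda>\<omega> k. X k \<omega>) \<in> measurable M ?P" using path_measurable[of 0] by simp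
  have transfer: "N.prob ((\<lambda>y k. v (int_iterate N T k y)) -` A \<inter> space N)
      = prob ((\<lambda>\<omega> k. X k \<omega>) -` A \<inter> space M)" if "A \<in> sets ?P" for A
    using measure_distr[OF path_N that] measure_distr[OF path_M that] by (simp add: law_fst)
  have "integrable N (\<lambda>y. v (int_iterate N T 0 y))"
    using integrable_distr_eq[OF path_N coordinate_measurable[of 0]]
      integrable_distr_eq[OF path_M coordinate_measurable[of 0]] X_integrable[of 0]
    by (simp add: law_fst)
  then have "integrable N v" by (simp add: int_iterate_def)
  then interpret mp_observable N T v by unfold_locales (use T inv in auto)
  interpret mixing_observable N T v "\<lambda>g. alpha_coeff M X (int g)"
  proof
    show "(\<lambda>g. alpha_coeff M X (int g)) \<longlonglongrightarrow> 0" using mix by (simp add: alpha_mixing_def)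
    fix a g A B assume A: "A \<in> sets (observed {..<a})" and B: "B \<in> sets (observed {a + g..})"
    \<comment> \<open>Observed events are written as preimages of path events to transport them to
      \<open>M\<close>, where the mixing coefficients live.\<close>
    have lift: "\<exists>A'\<in>path_events (int ` K). A = (\<lambda>y k. v (int_iterate N T k y)) -` A' \<inter> space N"
      if "A \<in> sets (observed K)" for A K
    proof -
      have "A \<in> sigma_sets (space N) {(\<lambda>y. v (int_iterate N T k y)) -` C \<inter> space N | k C.
          k \<in> int ` K \<and> C \<in> sets borel}"
        using that unfolding sets_observed
        by (rule subsetD[OF sigma_sets_mono', rotated]) (auto simp: iter_nat[symmetric])
      then show ?thesis unfolding path_events_vimage[symmetric] by blast
    qed
    obtain A' where A': "A' \<in> path_events (int ` {..<a})"
      "A = (\<lambda>y k. v (int_iterate N T k y)) -` A' \<inter> space N" using lift[OF A] by blast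
    obtain B' where B': "B' \<in> path_events (int ` {a + g..})"
      "B = (\<lambda>y k. v (int_iterate N T k y)) -` B' \<inter> space N" using lift[OF B] by blast
    have mono: "path_events K \<subseteq> path_events L" if "K \<subseteq> L" for K L
      unfolding path_events_def using that by (intro sigma_sets_mono') blast
    have A1: "A' \<in> path_events {..<int a}"
      using A'(1) by (rule mono[THEN subsetD, rotated]) auto
    have B1: "B' \<in> path_events {int a + int g..}"
      using B'(1) by (rule mono[THEN subsetD, rotated]) auto
    have "A \<inter> B = (\<lambda>y k. v (int_iterate N T k y)) -` (A' \<inter> B') \<inter> space N"
      using A'(2) B'(2) by auto
    moreover have "A' \<in> sets ?P" "B' \<in> sets ?P" using A1 B1 path_events_subset by blast+
    ultimately show "\<bar>N.prob (A \<inter> B) - N.prob A * N.prob B\<bar> \<le> alpha_coeff M X (int g)"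
      using path_events_mixing[OF A1 B1] A'(2) B'(2) by (simp only: transfer sets.Int)
  qed
  have moment: "(\<integral>y. cmod (W \<beta> m y) \<partial>N) = (\<integral>\<omega>. cmod (twisted_sum X \<beta> m \<omega>) \<partial>M)" for m
  proof -
    define F where "F w = cmod (\<Sum>k<m. cis (- (real k * \<beta>)) * w (int k))" for w :: "int \<Rightarrow> complex"
    have F: "F \<in> borel_measurable ?P" unfolding F_def[abs_def] by measurable
    show ?thesis
      using integral_distr[OF path_N F] integral_distr[OF path_M F]
      by (simp add: law_fst F_def W_def twisted_sum_def iter_nat)
  qed
  obtain C \<kappa> where C: "0 < C" and \<kappa>: "0 < \<kappa>" and dense: "\<And>N0. \<exists>n\<ge>N0. \<kappa> * harm n \<le>
      (\<Sum>m\<in>{m\<in>{1..n}. (\<integral>y. cmod (W \<beta> m y) \<partial>N) \<le> C * sqrt (real m)}. 1 / real m)"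
    using diff unfolding often_diffusive_def diffusive_times_def moment[symmetric] mem_Collect_eq
    by blast
  show ?thesis
    unfolding recurrent_cocycle_def
  proof (intro ballI allI impI)
    fix B U
    assume B: "B \<in> sets N" "0 < N.prob B" and U: "openin (top_of_set (carrier motion_group)) U"
      "\<one>\<^bsub>motion_group\<^esub> \<in> U"
    obtain \<delta> where \<delta>: "0 < \<delta>" and \<delta>U: "\<And>z u. cmod u = 1 \<Longrightarrow> cmod z < \<delta> \<Longrightarrow> cmod (u - 1) < \<delta> \<Longrightarrow> (z, u) \<in> U"
      using motion_group_nhd_one(2)[OF U] by blast
    \<comment> \<open>Along the forward orbit of a point of \<open>B1\<close> every rotation part is
      exactly \<open>cis \<beta>\<close>, so the cocycle is a genuine \<open>motion_walk\<close>
      there.\<close>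
    define B1 where "B1 = B \<inter> {y \<in> space N. \<forall>k::nat. snd (f ((T ^^ k) y)) = cis \<beta>}"
    have B1: "B1 \<in> sets N" unfolding B1_def using B by measurable
    have "N.prob B1 = N.prob B"
    proof (rule measure_eq_AE)
      show "AE y in N. y \<in> B1 \<longleftrightarrow> y \<in> B"
        using AE_snd AE_space
      proof eventually_elim
        case (elim y)
        have "snd (f ((T ^^ k) y)) = cis \<beta>" for k using elim(1)[rule_format, of "int k"] by (simp add: iter_nat)
        then show ?case using elim(2) by (simp add: B1_def)
      qed
    qed (use B B1 in auto)
    then obtain n where n: "1 \<le> n" and pos: "0 < N.prob (B1 \<inter> ((T ^^ n) -` B1 \<inter> space N)
        \<inter> {y \<in> space N. cmod (W \<beta> n y) < \<delta> \<and> cmod (cis (real n * \<beta>) - 1) < \<delta>})"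
      using recurrence[OF \<beta> B1 _ \<delta> C \<kappa> dense] B(2) by auto
    have cocycle: "cocycle N T f (int n) y = left_product (\<lambda>k. f ((T ^^ k) y)) n" for y
      by (simp add: cocycle_def)
    show "\<exists>n. n \<noteq> 0 \<and> 0 < N.prob (B \<inter> (int_iterate N T n -` B \<inter> space N)
        \<inter> {x \<in> space N. cocycle N T f n x \<in> U})"
    proof (intro exI[of _ "int n"] conjI)
      show "int n \<noteq> 0" using n by simp
      let ?D = "B \<inter> (int_iterate N T (int n) -` B \<inter> space N) \<inter> {x \<in> space N. cocycle N T f (int n) x \<in> U}"
      note pos
      also have "N.prob (B1 \<inter> ((T ^^ n) -` B1 \<inter> space N)
        \<inter> {y \<in> space N. cmod (W \<beta> n y) < \<delta> \<and> cmod (cis (real n * \<beta>) - 1) < \<delta>}) \<le> N.prob ?D"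
      proof (rule N.finite_measure_mono)
        have "(\<lambda>y. left_product (\<lambda>k. f ((T ^^ k) y)) n) \<in> borel_measurable N"
          by (rule left_product_measurable) (rule measurable_compose[OF funpow_measurable fb])
        from measurable_sets[OF this motion_group_nhd_one(1)[OF U]]
        have "{x \<in> space N. cocycle N T f (int n) x \<in> U} \<in> sets N"
          by (simp add: cocycle vimage_def Int_def conj_commute)
        then show "?D \<in> sets N"
          using B measurable_sets[OF iter B(1), of "int n"] by auto
        show "B1 \<inter> ((T ^^ n) -` B1 \<inter> space N)
            \<inter> {y \<in> space N. cmod (W \<beta> n y) < \<delta> \<and> cmod (cis (real n * \<beta>) - 1) < \<delta>} \<subseteq> ?D"
        proof
          fix y
          assume y: "y \<in> B1 \<inter> ((T ^^ n) -` B1 \<inter> space N)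
            \<inter> {y \<in> space N. cmod (W \<beta> n y) < \<delta> \<and> cmod (cis (real n * \<beta>) - 1) < \<delta>}"
          \<comment> \<open>\<open>nat\<close> sends negative indices to 0; the walk reads
            nonnegative ones only.\<close>
          define x where "x k y = v ((T ^^ nat k) y)" for k y
          have "f ((T ^^ k) y) = (x (int k) y, cis \<beta>)" for k
            using y by (simp add: B1_def x_def v_def prod_eq_iff)
          then have "cocycle N T f (int n) y = motion_walk \<beta> x n y"
            by (simp add: cocycle motion_walk_eq_left_product)
          moreover have "motion_walk \<beta> x n y \<in> U"
            unfolding motion_walk_def
          proof (rule \<delta>U)
            have "rotated_sum \<beta> x n y = cis ((real n - 1) * \<beta>) * W \<beta> n y"
              unfolding rotated_sum_def W_def x_def by (simp add: mult.commute)
            then have "cmod (rotated_sum \<beta> x n y) = cmod (W \<beta> n y)" by (simp add: norm_mult)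
            then show "cmod (rotated_sum \<beta> x n y) < \<delta>" using y by simp
          qed (use y in auto)
          ultimately show "y \<in> ?D" using y by (auto simp: B1_def iter_nat)
        qed
      qed
      finally show "0 < N.prob ?D" .
    qed
  qed
qed

corollary recurrent_motion_walk:
  assumes "alpha_mixing M X" "\<beta> \<in> irrational_angles" "often_diffusive M X \<beta>"
  shows "recurrent_walk TYPE('b) M (motion_walk \<beta> X)"
  unfolding recurrent_walk_def
proof (intro exI[of _ "\<lambda>k \<omega>. (X k \<omega>, cis \<beta>)"] conjI ballI allI impI)
  show "stationary_process M motion_borel (\<lambda>k \<omega>. (X k \<omega>, cis \<beta>))"
    by (rule increments_stationary) simp
  show "motion_walk \<beta> X n \<omega> = left_product (\<lambda>k. (X (int k) \<omega>, cis \<beta>)) n" for n \<omega>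
    by (rule motion_walk_eq_left_product)
  show "recurrent_cocycle N T f" if "realization M (\<lambda>k \<omega>. (X k \<omega>, cis \<beta>)) N T f"
    for N :: "'b measure" and T f
    by (rule recurrent_realization[OF assms that])
qed

end

theorem theorem1p1:
  fixes M :: "'a measure" and X :: "int \<Rightarrow> 'a \<Rightarrow> complex"
  assumes "prob_space M"
    and "stationary_process M borel X"
    and "alpha_mixing M X"
    and "\<And>k. integrable M (\<lambda>\<omega>. (cmod (X k \<omega>))\<^sup>2)"
  shows "(\<exists>A \<subseteq> irrational_angles. irrational_angles - A \<in> null_sets lebesgue \<and>
            (\<forall>\<beta>\<in>A. recurrent_walk TYPE('b) M (motion_walk \<beta> X))) \<and>
         (summable (\<lambda>k::nat. cmod (\<integral>\<omega>. X (int k) \<omega> * cnj (X 0 \<omega>) \<partial>M)) \<longrightarrow>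
            (\<forall>\<beta>\<in>irrational_angles. recurrent_walk TYPE('b) M (motion_walk \<beta> X)))"
proof -
  interpret prob_space M by fact
  interpret square_integrable_process M X by unfold_locales (fact assms)+
  note walk = recurrent_motion_walk[OF assms(3), where ?'b = 'b]
  show ?thesis
  proof (intro conjI impI ballI)
    define A where "A = {\<beta> \<in> irrational_angles. often_diffusive M X \<beta>}"
    obtain E where E: "E \<in> null_sets lborel"
      "{\<beta> \<in> space lborel. \<not> (\<beta> \<in> {0..2 * pi} \<longrightarrow> often_diffusive M X \<beta>)} \<subseteq> E"
      using AE_often_diffusive unfolding eventually_ae_filter by blast
    \<comment> \<open>The exceptional set is only known to lie inside a Borel null set, so it is
      null for the completed measure.\<close>
    have "irrational_angles - A \<subseteq> E"
      using E(2) by (auto simp: A_def irrational_angles_def)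
    then have "irrational_angles - A \<in> null_sets lebesgue"
      using E(1) null_sets_completionI null_sets_completion_subset by blast
    then show "\<exists>A \<subseteq> irrational_angles. irrational_angles - A \<in> null_sets lebesgue \<and>
        (\<forall>\<beta>\<in>A. recurrent_walk TYPE('b) M (motion_walk \<beta> X))"
      using walk by (intro exI[of _ A]) (auto simp: A_def)
  next
    fix \<beta>
    assume "summable (\<lambda>k::nat. cmod (\<integral>\<omega>. X (int k) \<omega> * cnj (X 0 \<omega>) \<partial>M))"
    then have "often_diffusive M X \<beta>"
      by (intro often_diffusive_if_summable) (simp add: covariance_def)
    moreover assume "\<beta> \<in> irrational_angles"
    ultimately show "recurrent_walk TYPE('b) M (motion_walk \<beta> X)" by (intro walk)
  qed
qed

end
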